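(* Let $g\geq 2$ and $r\ge1$ be integers, let $\mathbf{a}=(a_1,\dots,a_r)\in\mathbb{N}^r$, and let $\mathbf{f}=(f_1,\dots,f_r)$ be a collection of $g$-additive functions that is eventually periodic with respect to $\mathbf{a}$. Let $\Sigma\subseteq\{0,\dots,g-1\}^{\mathbb{N}_0}$ be a mixing, sofic and regular subshift, and let $(p,\ell)$ be an eventual period such that $\Sigma$ has a synchronizing word of length $\ell$. If the Markov condition holds (that is, the matrix $M_i$ is irreducible and aperiodic for every $i\geq\ell$), then $$\lim_{N\to\infty}\frac{|\{n\in A_\Sigma:\ f_j(n)\equiv b_j \pmod{a_j}\text{ for } j=1,\dots,r\}\cap[0,N)|}{|A_\Sigma\cap[0,N)|}=\frac{1}{a_1a_2\cdots a_r}$$ for every $\mathbf{b}=(b_1,\dots,b_r)\in\mathbb{Z}/a_1\mathbb{Z}\times\dots\times\mathbb{Z}/a_r\mathbb{Z}$.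
   Context: $\mathbb{N}=\{1,2,\dots\}$, $\mathbb{N}_0=\mathbb{N}\cup\{0\}$. A function $f:\mathbb{N}_0\to\mathbb{Z}$ is $g$-additive if $f(\sum_{i=0}^m w_ig^i)=\sum_{i=0}^m f(w_ig^i)$ for all $w_0,\dots,w_m\in\{0,\dots,g-1\}$. Write $\mathbb{Z}_{\mathbf a}=\mathbb{Z}/a_1\mathbb{Z}\times\dots\times\mathbb{Z}/a_r\mathbb{Z}$, and $\mathbf f(n)\equiv\mathbf b \bmod \mathbf a$ if $f_j(n)\equiv b_j\pmod{a_j}$ for all $j$. $\mathbf f$ is eventually periodic with respect to $\mathbf a$ if there are $p\in\mathbb{N}$, $\ell\in\mathbb{N}_0$ with $\mathbf f(dg^{i+np})\equiv\mathbf f(dg^i)\bmod\mathbf a$ for all $d\in\{0,\dots,g-1\}$, $n\in\mathbb{N}$, $i\ge\ell$; any such $(p,\ell)$ is called an eventual period. A subshift $\Sigma\subseteq\{0,\dots,g-1\}^{\mathbb{N}_0}$ is a non-empty closed set invariant under the left shift ($\sigma(\Sigma)\subseteq\Sigma$). $\mathcal{L}(\Sigma)$ is the set of finite words (including the empty one) that are initial segments of elements of $\Sigma$; $\mathcal{L}^n(\Sigma)$ is the set of those of length $n$. $\Sigma$ is transitive if for all $u,v\in\mathcal{L}(\Sigma)$ there is $w\in\mathcal{L}(\Sigma)$ with $uwv\in\mathcal{L}(\Sigma)$; mixing if for all $u,v\in\mathcal{L}(\Sigma)$ there is $n$ such that for every $m\ge n$ there is $w\in\mathcal{L}^m(\Sigma)$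 with $uwv\in\mathcal{L}(\Sigma)$; sofic if it is the set of label sequences of infinite paths in some finite edge-labelled directed multigraph. For a word $w=w_0\cdots w_{n-1}$ put $(w)_g=w_0+w_1g+\dots+w_{n-1}g^{n-1}$, and $A_\Sigma=\{(w)_g:w\in\mathcal{L}(\Sigma)\}$. The follower set of $w\in\mathcal{L}(\Sigma)$ is $F(w)=\{v\in\mathcal{L}(\Sigma):wv\in\mathcal{L}(\Sigma)\}$. A word $w\in\mathcal{L}(\Sigma)$ is synchronizing if for all $u,v\in\mathcal{L}(\Sigma)$, $uw\in\mathcal{L}(\Sigma)$ and $wv\in\mathcal{L}(\Sigma)$ imply $uwv\in\mathcal{L}(\Sigma)$. For $\Sigma$ transitive and sofic, the Fischer cover $\mathcal{G}$ is the labelled directed graph with (finite) node set $\mathcal{V}=\{F(w): w\in\mathcal{L}(\Sigma)\text{ synchronizing}\}$ and an edge labelled by the digit $d$ from $F$ to $F'$ whenever $F=F(w)$, $wd\in\mathcal{L}(\Sigma)$ and $F'=F(wd)$ for some word $w$. Write $F\overset{w}{\to}F'$ if $\mathcal{G}$ has a path from $F$ to $F'$ labelled by $w$. A transitive sofic subshift is $k$-regular if every node of its Fischer cover has exactly $k$ incoming and exactly $k$ outgoing edges (edges differing in starting node, terminal node or label being distinct), and regular if it is $k$-regular for some $k\ge2$. For $i\in\mathbb{N}$, $\mathbf b\in\mathbb{Z}_{\mathbf a}$, $F,F'\in\mathcal{V}$, let $E_i(\mathbf b,F,F')=\{w\in\mathcal{L}^p(\Sigma):\mathbf f(g^i(w)_g)\equiv\mathbf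 b\bmod\mathbf a,\ F\overset{w}{\to}F'\}$. With $\Sigma$ $k$-regular, $M_i$ is the matrix indexed by $\mathcal{S}\times\mathcal{S}$, $\mathcal{S}=\mathbb{Z}_{\mathbf a}\times\mathcal{V}$, with $M_i((\mathbf b,F),(\mathbf b',F'))=k^{-p}|E_i(\mathbf b'-\mathbf b,F,F')|$. A stochastic matrix $M$ is irreducible if for all $s,s'$ there is $n\in\mathbb{N}$ with $M^n(s,s')>0$, and aperiodic if $\gcd\{n\in\mathbb{N}:M^n(s,s)>0\}=1$ for every state $s$. *)

theory Defs
  imports
    "HOL-Analysis.Analysis"
    "HOL-Number_Theory.Cong"
    "Graph_Theory.Arc_Walk"
begin

text \<open>
  An \<open>r\<close>-tuple is a function on \<open>nat\<close> of which only the values at \<open>1, ..., r\<close> matter.  Digits are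
  natural numbers below \<open>g\<close>, finite words are lists and infinite words are functions on \<open>nat\<close>.
\<close>

definition g_additive :: "nat \<Rightarrow> (nat \<Rightarrow> int) \<Rightarrow> bool" where
  "g_additive g f \<longleftrightarrow>
     (\<forall>m w. (\<forall>i\<le>m. w i < g) \<longrightarrow> f (\<Sum>i\<le>m. w i * g ^ i) = (\<Sum>i\<le>m. f (w i * g ^ i)))"

text \<open>The group \<open>\<int>/a\<^sub>1\<int> \<times> ... \<times> \<int>/a\<^sub>r\<int>\<close>, each class represented by its least non-negative element.\<close>

definition residue_tuples :: "nat \<Rightarrow> (nat \<Rightarrow> nat) \<Rightarrow> (nat \<Rightarrow> int) set" where
  "residue_tuples r a = (\<Pi>\<^sub>E j\<in>{1..r}. {0..<int (a j)})"

definition cong_tuple :: "nat \<Rightarrow> (nat \<Rightarrow> nat) \<Rightarrow> (nat \<Rightarrow> int) \<Rightarrow> (nat \<Rightarrow> int) \<Rightarrow> bool" where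
  "cong_tuple r a x y \<longleftrightarrow> (\<forall>j\<in>{1..r}. [x j = y j] (mod int (a j)))"

definition eventual_period ::
    "nat \<Rightarrow> nat \<Rightarrow> (nat \<Rightarrow> nat) \<Rightarrow> (nat \<Rightarrow> nat \<Rightarrow> int) \<Rightarrow> nat \<Rightarrow> nat \<Rightarrow> bool" where
  "eventual_period g r a f p l \<longleftrightarrow> p \<ge> 1 \<and>
     (\<forall>d<g. \<forall>n\<ge>1. \<forall>i\<ge>l. cong_tuple r a (\<lambda>j. f j (d * g ^ (i + n * p))) (\<lambda>j. f j (d * g ^ i)))"

definition eventually_periodic ::
    "nat \<Rightarrow> nat \<Rightarrow> (nat \<Rightarrow> nat) \<Rightarrow> (nat \<Rightarrow> nat \<Rightarrow> int) \<Rightarrow> bool" where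
  "eventually_periodic g r a f \<longleftrightarrow> (\<exists>p l. eventual_period g r a f p l)"


section \<open>Subshifts\<close>

text \<open>
  \<open>closed\<close> refers to the product topology on \<open>nat \<Rightarrow> nat\<close> with discrete factors, in which the full
  shift is itself closed.
\<close>

definition subshift :: "nat \<Rightarrow> (nat \<Rightarrow> nat) set \<Rightarrow> bool" where
  "subshift g \<Sigma> \<longleftrightarrow> \<Sigma> \<subseteq> {x. \<forall>i. x i < g} \<and> \<Sigma> \<noteq> {} \<and> closed \<Sigma> \<and> (\<lambda>x i. x (Suc i)) ` \<Sigma> \<subseteq> \<Sigma>"

definition language :: "(nat \<Rightarrow> nat) set \<Rightarrow> nat list set" where
  "language \<Sigma> = {map x [0..<n] | x n. x \<in> \<Sigma>}"

definition language_n :: "(nat \<Rightarrow> nat) set \<Rightarrow> nat \<Rightarrow> nat list set" where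
  "language_n \<Sigma> n = {w \<in> language \<Sigma>. length w = n}"

definition transitive_shift :: "(nat \<Rightarrow> nat) set \<Rightarrow> bool" where
  "transitive_shift \<Sigma> \<longleftrightarrow>
     (\<forall>u\<in>language \<Sigma>. \<forall>v\<in>language \<Sigma>. \<exists>w\<in>language \<Sigma>. u @ w @ v \<in> language \<Sigma>)"

definition mixing_shift :: "(nat \<Rightarrow> nat) set \<Rightarrow> bool" where
  "mixing_shift \<Sigma> \<longleftrightarrow>
     (\<forall>u\<in>language \<Sigma>. \<forall>v\<in>language \<Sigma>. \<exists>n. \<forall>m\<ge>n. \<exists>w\<in>language_n \<Sigma> m. u @ w @ v \<in> language \<Sigma>)"

text \<open>
  Every finite multigraph is isomorphic to one whose vertices and arcs are natural numbers, so the
  existential quantifier below covers all finite labelled multigraphs.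
\<close>

definition sofic :: "(nat \<Rightarrow> nat) set \<Rightarrow> bool" where
  "sofic \<Sigma> \<longleftrightarrow>
     (\<exists>(G :: (nat, nat) pre_digraph) lab. fin_digraph G \<and>
        \<Sigma> = {\<lambda>i. lab (e i) | e. \<forall>i. e i \<in> arcs G \<and> head G (e i) = tail G (e (Suc i))})"

definition word_val :: "nat \<Rightarrow> nat list \<Rightarrow> nat" where
  "word_val g w = (\<Sum>i<length w. w ! i * g ^ i)"

definition A_set :: "nat \<Rightarrow> (nat \<Rightarrow> nat) set \<Rightarrow> nat set" where
  "A_set g \<Sigma> = word_val g ` language \<Sigma>"


section \<open>The Fischer cover\<close>

definition follower :: "(nat \<Rightarrow> nat) set \<Rightarrow> nat list \<Rightarrow> nat list set" where
  "follower \<Sigma> w = {v \<in> language \<Sigma>. w @ v \<in> language \<Sigma>}"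

definition synchronizing :: "(nat \<Rightarrow> nat) set \<Rightarrow> nat list \<Rightarrow> bool" where
  "synchronizing \<Sigma> w \<longleftrightarrow> w \<in> language \<Sigma> \<and>
     (\<forall>u\<in>language \<Sigma>. \<forall>v\<in>language \<Sigma>.
        u @ w \<in> language \<Sigma> \<longrightarrow> w @ v \<in> language \<Sigma> \<longrightarrow> u @ w @ v \<in> language \<Sigma>)"

definition fischer_nodes :: "(nat \<Rightarrow> nat) set \<Rightarrow> nat list set set" where
  "fischer_nodes \<Sigma> = {follower \<Sigma> w | w. synchronizing \<Sigma> w}"

type_synonym fischer_arc = "nat list set \<times> nat \<times> nat list set"

text \<open>An arc is a triple of its initial node, its label and its terminal node.\<close>

definition fischer_cover :: "(nat \<Rightarrow> nat) set \<Rightarrow> (nat list set, fischer_arc) pre_digraph" where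
  "fischer_cover \<Sigma> =
     \<lparr> verts = fischer_nodes \<Sigma>,
       arcs = {(F, d, F'). F \<in> fischer_nodes \<Sigma> \<and> F' \<in> fischer_nodes \<Sigma> \<and>
                 (\<exists>w. w \<in> language \<Sigma> \<and> F = follower \<Sigma> w \<and>
                      w @ [d] \<in> language \<Sigma> \<and> F' = follower \<Sigma> (w @ [d]))},
       tail = (\<lambda>(F, d, F'). F),
       head = (\<lambda>(F, d, F'). F') \<rparr>"

definition fischer_label :: "fischer_arc \<Rightarrow> nat" where
  "fischer_label = (\<lambda>(F, d, F'). d)"

definition fischer_path ::
    "(nat \<Rightarrow> nat) set \<Rightarrow> nat list set \<Rightarrow> nat list \<Rightarrow> nat list set \<Rightarrow> bool" where
  "fischer_path \<Sigma> F w F' \<longleftrightarrow>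
     (\<exists>es. pre_digraph.awalk (fischer_cover \<Sigma>) F es F' \<and> map fischer_label es = w)"

definition k_regular :: "nat \<Rightarrow> nat \<Rightarrow> (nat \<Rightarrow> nat) set \<Rightarrow> bool" where
  "k_regular g k \<Sigma> \<longleftrightarrow> subshift g \<Sigma> \<and> transitive_shift \<Sigma> \<and> sofic \<Sigma> \<and>
     (\<forall>F \<in> verts (fischer_cover \<Sigma>).
        finite (in_arcs (fischer_cover \<Sigma>) F) \<and> in_degree (fischer_cover \<Sigma>) F = k \<and>
        finite (out_arcs (fischer_cover \<Sigma>) F) \<and> out_degree (fischer_cover \<Sigma>) F = k)"


section \<open>The Markov condition\<close>

definition E_words ::
    "nat \<Rightarrow> nat \<Rightarrow> (nat \<Rightarrow> nat) \<Rightarrow> (nat \<Rightarrow> nat \<Rightarrow> int) \<Rightarrow> (nat \<Rightarrow> nat) set \<Rightarrow> nat \<Rightarrow> nat \<Rightarrow>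
     (nat \<Rightarrow> int) \<Rightarrow> nat list set \<Rightarrow> nat list set \<Rightarrow> nat list set" where
  "E_words g r a f \<Sigma> p i b F F' =
     {w \<in> language_n \<Sigma> p.
        cong_tuple r a (\<lambda>j. f j (g ^ i * word_val g w)) b \<and> fischer_path \<Sigma> F w F'}"

type_synonym state = "(nat \<Rightarrow> int) \<times> nat list set"

definition states :: "nat \<Rightarrow> (nat \<Rightarrow> nat) \<Rightarrow> (nat \<Rightarrow> nat) set \<Rightarrow> state set" where
  "states r a \<Sigma> = residue_tuples r a \<times> fischer_nodes \<Sigma>"

text \<open>
  The difference \<open>b' - b\<close> is taken in the integers; this is harmless because \<open>E_words\<close> depends
  only on the residue class of its tuple argument.
\<close>

definition M_matrix ::
    "nat \<Rightarrow> nat \<Rightarrow> (nat \<Rightarrow> nat) \<Rightarrow> (nat \<Rightarrow> nat \<Rightarrow> int) \<Rightarrow> (nat \<Rightarrow> nat) set \<Rightarrow> nat \<Rightarrow> nat \<Rightarrow> nat \<Rightarrow>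
     state \<Rightarrow> state \<Rightarrow> real" where
  "M_matrix g r a f \<Sigma> k p i =
     (\<lambda>(b, F) (b', F'). real (card (E_words g r a f \<Sigma> p i (\<lambda>j. b' j - b j) F F')) / real k ^ p)"

text \<open>Matrices indexed by a finite set \<open>S\<close> are functions of two arguments restricted to \<open>S\<close>.\<close>

primrec matrix_power :: "'s set \<Rightarrow> ('s \<Rightarrow> 's \<Rightarrow> real) \<Rightarrow> nat \<Rightarrow> 's \<Rightarrow> 's \<Rightarrow> real" where
  "matrix_power S M 0 = (\<lambda>s s'. if s = s' then 1 else 0)"
| "matrix_power S M (Suc n) = (\<lambda>s s'. \<Sum>t\<in>S. matrix_power S M n s t * M t s')"

definition irreducible_matrix :: "'s set \<Rightarrow> ('s \<Rightarrow> 's \<Rightarrow> real) \<Rightarrow> bool" where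
  "irreducible_matrix S M \<longleftrightarrow> (\<forall>s\<in>S. \<forall>s'\<in>S. \<exists>n\<ge>1. matrix_power S M n s s' > 0)"

definition aperiodic_matrix :: "'s set \<Rightarrow> ('s \<Rightarrow> 's \<Rightarrow> real) \<Rightarrow> bool" where
  "aperiodic_matrix S M \<longleftrightarrow> (\<forall>s\<in>S. Gcd {n. n \<ge> 1 \<and> matrix_power S M n s s > 0} = (1::nat))"

definition markov_condition ::
    "nat \<Rightarrow> nat \<Rightarrow> (nat \<Rightarrow> nat) \<Rightarrow> (nat \<Rightarrow> nat \<Rightarrow> int) \<Rightarrow> (nat \<Rightarrow> nat) set \<Rightarrow> nat \<Rightarrow> nat \<Rightarrow> nat \<Rightarrow> bool" where
  "markov_condition g r a f \<Sigma> k p l \<longleftrightarrow>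
     (\<forall>i\<ge>1. i \<ge> l \<longrightarrow>
        irreducible_matrix (states r a \<Sigma>) (M_matrix g r a f \<Sigma> k p i) \<and>
        aperiodic_matrix (states r a \<Sigma>) (M_matrix g r a f \<Sigma> k p i))"

end

theory Submission
  imports Defs
begin

text \<open>
  A node \<open>F\<close> of the Fischer cover is a set of words, and the path labelled \<open>w\<close> from \<open>F\<close> exists iff
  \<open>w \<in> F\<close>, in which case it ends in \<open>{v. w @ v \<in> F}\<close>.  By regularity the matrices \<open>M\<^sub>i\<close> are doubly
  stochastic, so by the Markov condition their powers converge to the uniform matrix: the values
  of \<open>f\<close> on long words equidistribute, separately for each initial and terminal node.  As words
  that are not synchronizing are exponentially rare, the same holds for the words \<open>u\<close> of length \<open>n\<close>
  with \<open>u @ v\<close> in the language, with an error \<open>o(k\<^sup>n)\<close> uniform in \<open>v\<close>.  Fixing the high digits \<open>v\<close>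
  gives equidistribution on the intervals \<open>[q g\<^sup>n, (q + 1) g\<^sup>n)\<close> with \<open>q \<ge> 1\<close>, and \<open>[0, N)\<close> is cut
  into such intervals.
\<close>

section \<open>Powers of doubly stochastic matrices\<close>

text \<open>Two obstacles shape the argument. The matrices govern words read from a node, and a
  prefix is known to lead to a node when it is synchronizing; so words are cut into a prefix
  \<open>u\<close>, almost always synchronizing, and a rest \<open>x\<close>. Whether
  \<open>u @ x @ v\<close> stays in the language then depends on \<open>x\<close> only through its
  terminal node, which must contain \<open>v\<close>. Hence the limit is taken for every pair of
  nodes, and the bounds come out independent of \<open>v\<close>. Secondly, digits are listed from
  the lowest one, and zeros at the end of a word do not change its value, so an integer may arise
  from words of several lengths. For \<open>q \<ge> 1\<close> every word of an integer in the
  interval with index \<open>q\<close> has at least \<open>n\<close> letters, and what follows the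
  first \<open>n\<close> begins with the shortest word of value \<open>q\<close>; so words of one
  fixed length describe the interval. For \<open>q = 0\<close> this breaks down: a word shorter than
  \<open>n\<close> may leave the language when padded with zeros. Errors \<open>o(k^n)\<close>
  suffice because \<open>A\<close> has at least \<open>k^n\<close> elements below
  \<open>g^n\<close>.\<close>

lemma matrix_power_add:
  assumes "finite S" "s' \<in> S"
  shows "matrix_power S M (m + n) s s' = (\<Sum>t\<in>S. matrix_power S M m s t * matrix_power S M n t s')"
  using assms(2)
proof (induction n arbitrary: s')
  case 0
  have "(\<Sum>t\<in>S. matrix_power S M m s t * (if t = s' then 1 else 0))
      = (\<Sum>t\<in>S. if t = s' then matrix_power S M m s t else 0)"
    by (rule sum.cong) auto
  with 0 \<open>finite S\<close> show ?case by (simp add: sum.delta)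
next
  case (Suc n)
  have "matrix_power S M (m + Suc n) s s'
      = (\<Sum>t\<in>S. \<Sum>u\<in>S. matrix_power S M m s u * matrix_power S M n u t * M t s')"
    by (simp add: Suc.IH sum_distrib_right)
  also have "\<dots> = (\<Sum>u\<in>S. \<Sum>t\<in>S. matrix_power S M m s u * matrix_power S M n u t * M t s')"
    by (rule sum.swap)
  finally show ?case by (simp add: sum_distrib_left mult.assoc)
qed

lemma matrix_power_nonneg:
  assumes "\<And>s t. s \<in> S \<Longrightarrow> t \<in> S \<Longrightarrow> M s t \<ge> 0" "s \<in> S" "t \<in> S"
  shows "matrix_power S M n s t \<ge> 0"
  using assms(2,3) by (induction n arbitrary: t) (auto intro!: sum_nonneg mult_nonneg_nonneg assms(1))

lemma matrix_power_pos_add: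
  assumes "finite S" and nn: "\<And>s t. s \<in> S \<Longrightarrow> t \<in> S \<Longrightarrow> M s t \<ge> 0" and "s \<in> S" "t \<in> S" "u \<in> S"
    and "matrix_power S M m s t > 0" "matrix_power S M n t u > 0"
  shows "matrix_power S M (m + n) s u > 0"
  unfolding matrix_power_add[OF \<open>finite S\<close> \<open>u \<in> S\<close>]
  using assms by (intro sum_pos2[where i = t]) (auto intro!: mult_nonneg_nonneg matrix_power_nonneg)

lemma matrix_power_row_sum:
  assumes "finite S" "\<And>s. s \<in> S \<Longrightarrow> (\<Sum>t\<in>S. M s t) = 1" "s \<in> S"
  shows "(\<Sum>t\<in>S. matrix_power S M n s t) = 1"
proof (induction n)
  case (Suc n)
  have "(\<Sum>t\<in>S. matrix_power S M (Suc n) s t)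
      = (\<Sum>u\<in>S. \<Sum>t\<in>S. matrix_power S M n s u * M u t)"
    unfolding matrix_power.simps by (rule sum.swap)
  then show ?case using Suc assms(2) by (simp flip: sum_distrib_left)
qed (use assms in simp)

lemma matrix_power_column_sum:
  assumes "finite S" "\<And>t. t \<in> S \<Longrightarrow> (\<Sum>s\<in>S. M s t) = 1" "t \<in> S"
  shows "(\<Sum>s\<in>S. matrix_power S M n s t) = 1"
  using assms(3)
proof (induction n arbitrary: t)
  case (Suc n)
  have "(\<Sum>s\<in>S. matrix_power S M (Suc n) s t)
      = (\<Sum>u\<in>S. \<Sum>s\<in>S. matrix_power S M n s u * M u t)"
    unfolding matrix_power.simps by (rule sum.swap)
  then show ?case using Suc assms(2) by (simp flip: sum_distrib_right)
qed (use assms in simp)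

text \<open>The least positive difference of two elements divides every element, hence is 1. Two
  consecutive elements \<open>z\<close> and \<open>Suc z\<close> then generate each
  \<open>n \<ge> z * z\<close>: with quotient \<open>q \<ge> z\<close> and remainder
  \<open>r < z\<close>, \<open>n = (q - r) * z + r * Suc z\<close>.\<close>

lemma additive_Gcd_1_cofinite:
  fixes T :: "nat set"
  assumes add: "\<And>x y. x \<in> T \<Longrightarrow> y \<in> T \<Longrightarrow> x + y \<in> T" and gcd: "Gcd T = 1"
  shows "eventually (\<lambda>n. n \<in> T) sequentially"
proof -
  have mult: "Suc c * x \<in> T" if "x \<in> T" for c x
    by (induction c) (use that add in auto)
  define P where "P d \<longleftrightarrow> d \<ge> 1 \<and> (\<exists>x\<in>T. x + d \<in> T)" for d :: nat
  obtain x0 where x0: "x0 \<in> T" "x0 \<ge> 1"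
  proof -
    have "\<not> T \<subseteq> {0}"
      using gcd Gcd_0_iff[of T] by fastforce
    then show ?thesis using that by fastforce
  qed
  have "P x0" using x0 add by (auto simp: P_def)
  define d where "d = (LEAST d. P d)"
  have "P d" unfolding d_def by (rule LeastI[of P, OF \<open>P x0\<close>])
  then obtain x where x: "x \<in> T" "x + d \<in> T" "d \<ge> 1" by (auto simp: P_def)
  have least: "d \<le> e" if "P e" for e unfolding d_def using that by (rule Least_le)
  have "d dvd y" if y: "y \<in> T" for y
  proof (rule ccontr)
    assume "\<not> d dvd y"
    then have m: "1 \<le> y mod d" by (simp add: dvd_eq_mod_eq_0 Suc_le_eq)
    \<comment> \<open>\<open>c * x + y\<close> and \<open>c * (x + d)\<close> differ by
      \<open>y mod d\<close>, which is positive and below \<open>d\<close>. For \<open>c = 0\<close>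
      the second number is 0 and need not lie in \<open>T\<close>; there \<open>y\<close> itself is
      below \<open>d\<close> and is the difference of \<open>y + y\<close> and
      \<open>y\<close>.\<close>
    define c where "c = y div d"
    have "y = c * d + y mod d" by (simp add: c_def)
    show False
    proof (cases c)
      case 0
      then have "y = y mod d" using \<open>y = c * d + y mod d\<close> by simp
      then have "y < d" using x(3) by (metis mod_less_divisor less_le_trans zero_less_one)
      moreover have "P y" using \<open>\<not> d dvd y\<close> add[OF y y] y by (cases y) (auto simp: P_def intro!: bexI[of _ y])
      ultimately show False using least by fastforce
    next
      case (Suc c')
      have "c * (x + d) \<in> T" unfolding Suc by (rule mult[OF x(2)])
      moreover have "c * (x + d) + y mod d \<in> T"
      proof -
        have "c * (x + d) + y mod d = c * x + y"
          using \<open>y = c * d + y mod d\<close> by (simp add: algebra_simps)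
        also have "\<dots> \<in> T" using mult[OF x(1), of c'] y add Suc by simp
        finally show ?thesis .
      qed
      ultimately have "P (y mod d)" using m by (auto simp: P_def)
      then show False using least x(3) by (meson leD less_le_trans mod_less_divisor zero_less_one)
    qed
  qed
  then have "d dvd Gcd T" by (rule Gcd_greatest)
  then have [simp]: "d = 1" using gcd by simp
  \<comment> \<open>Since \<open>x\<close> may be 0, the positive \<open>x0\<close> is added to both
    consecutive elements.\<close>
  define z where "z = x + x0"
  have z: "z \<in> T" "Suc z \<in> T" "z \<ge> 1"
    using x x0 add[of "x + 1" x0] add[of x x0] by (auto simp: z_def)
  have "n \<in> T" if "n \<ge> z * z" for n
  proof -
    define q r where "q = n div z" and "r = n mod z"
    have "r < z" using z by (simp add: r_def)
    have "z \<le> q" unfolding q_def using that z by (metis div_le_mono nonzero_mult_div_cancel_right not_one_le_zero)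
    obtain e where e: "q - r = Suc e" using \<open>r < z\<close> \<open>z \<le> q\<close> by (metis Suc_diff_Suc less_le_trans)
    have "n = q * z + r" by (simp add: q_def r_def)
    also have "q = Suc e + r" using e by simp
    finally have n: "n = Suc e * z + r * Suc z" by (simp add: algebra_simps)
    show ?thesis
    proof (cases r)
      case 0
      with n show ?thesis using mult[OF z(1)] by simp
    next
      case (Suc r')
      then show ?thesis unfolding n using mult[OF z(1)] mult[OF z(2)] add by metis
    qed
  qed
  then show ?thesis by (auto simp: eventually_sequentially)
qed

text \<open>The return times to \<open>s\<close> are closed under addition and have gcd 1, so they
  contain every large \<open>n\<close>; one fixed transition from \<open>s\<close> to
  \<open>t\<close> is appended.\<close>

lemma irreducible_aperiodic_eventually_pos:
  assumes "finite S" and nn: "\<And>s t. s \<in> S \<Longrightarrow> t \<in> S \<Longrightarrow> M s t \<ge> 0"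
    and irr: "irreducible_matrix S M" and aper: "aperiodic_matrix S M"
  shows "eventually (\<lambda>n. \<forall>s\<in>S. \<forall>t\<in>S. matrix_power S M n s t > 0) sequentially"
proof (intro eventually_ball_finite ballI \<open>finite S\<close>)
  fix s t assume st: "s \<in> S" "t \<in> S"
  obtain m where m: "matrix_power S M m s t > 0"
    using irr st unfolding irreducible_matrix_def by blast
  let ?T = "{n. n \<ge> 1 \<and> matrix_power S M n s s > 0}"
  have "eventually (\<lambda>n. n \<in> ?T) sequentially"
    by (rule additive_Gcd_1_cofinite)
      (use aper st in \<open>auto simp: aperiodic_matrix_def intro: matrix_power_pos_add assms\<close>)
  then have "eventually (\<lambda>n. matrix_power S M (n + m) s t > 0) sequentially"
    by eventually_elim (auto intro: matrix_power_pos_add assms st m)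
  then show "eventually (\<lambda>n. matrix_power S M n s t > 0) sequentially"
    by (subst (asm) eventually_sequentially_seg)
qed

lemma power_div_tendsto_0:
  fixes x :: real
  assumes "0 \<le> x" "x < 1" "m \<ge> 1"
  shows "(\<lambda>n. x ^ (n div m)) \<longlonglongrightarrow> 0"
proof -
  have "filterlim (\<lambda>n. n div m) sequentially sequentially"
    unfolding filterlim_at_top eventually_sequentially
    using assms(3) by (metis div_le_mono nonzero_mult_div_cancel_right not_one_le_zero)
  then show ?thesis
    by (rule filterlim_compose[rotated]) (use assms in \<open>intro LIMSEQ_realpow_zero\<close>)
qed

text \<open>
  A column of \<open>M\<^sup>n\<close> minus its mean sums to zero, so applying a power of \<open>M\<close> whose entries are
  all at least \<open>\<delta>\<close> shrinks its maximum norm by the factor \<open>1 - |S| \<delta>\<close>.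
\<close>

lemma doubly_stochastic_power_limit:
  assumes "finite S" and nn: "\<And>s t. s \<in> S \<Longrightarrow> t \<in> S \<Longrightarrow> M s t \<ge> 0"
    and row: "\<And>s. s \<in> S \<Longrightarrow> (\<Sum>t\<in>S. M s t) = 1" and col: "\<And>t. t \<in> S \<Longrightarrow> (\<Sum>s\<in>S. M s t) = 1"
    and irr: "irreducible_matrix S M" and aper: "aperiodic_matrix S M"
    and "s \<in> S" "t \<in> S"
  shows "(\<lambda>n. matrix_power S M n s t) \<longlonglongrightarrow> 1 / card S"
proof -
  let ?P = "matrix_power S M"
  obtain m where m: "m \<ge> 1" "\<And>s t. s \<in> S \<Longrightarrow> t \<in> S \<Longrightarrow> ?P m s t > 0"
    using irreducible_aperiodic_eventually_pos[OF \<open>finite S\<close> nn irr aper]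
    unfolding eventually_sequentially by (metis nat_le_linear)
  have "S \<noteq> {}" using \<open>s \<in> S\<close> by auto
  define \<delta> where "\<delta> = Min ((\<lambda>(s, t). ?P m s t) ` (S \<times> S))"
  have \<delta>: "\<delta> > 0" "\<And>s t. s \<in> S \<Longrightarrow> t \<in> S \<Longrightarrow> \<delta> \<le> ?P m s t"
    using \<open>finite S\<close> \<open>S \<noteq> {}\<close> m(2) by (auto simp: \<delta>_def Min_gr_iff intro!: Min_le)
  \<comment> \<open>The mass that a row of \<open>?P m\<close> keeps after \<open>\<delta>\<close>
    is taken off each entry; it is the contraction factor.\<close>
  define \<rho> where "\<rho> = 1 - card S * \<delta>"
  have excess: "(\<Sum>u\<in>S. ?P m s u - \<delta>) = \<rho>" if "s \<in> S" for s
    using matrix_power_row_sum[OF \<open>finite S\<close> row that] by (simp add: sum_subtractf \<rho>_def)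
  have "\<rho> \<ge> 0"
    using sum_nonneg[of S "\<lambda>u. ?P m s u - \<delta>"] \<delta>(2) \<open>s \<in> S\<close> excess[of s] by auto
  have "\<rho> < 1" using \<delta>(1) \<open>S \<noteq> {}\<close> \<open>finite S\<close> by (simp add: \<rho>_def card_gt_0_iff)
  have cS: "card S > 0" using \<open>S \<noteq> {}\<close> \<open>finite S\<close> by (simp add: card_gt_0_iff)
  have bound: "\<bar>?P (q * m + n) s t - 1 / card S\<bar> \<le> \<rho> ^ q" if "s \<in> S" for q n s
    using that
  proof (induction q arbitrary: s)
    case 0
    have "?P n s t \<le> (\<Sum>u\<in>S. ?P n s u)"
      using \<open>finite S\<close> 0 \<open>t \<in> S\<close> by (intro member_le_sum) (auto intro!: matrix_power_nonneg nn)
    also have "\<dots> = 1" by (rule matrix_power_row_sum[OF \<open>finite S\<close> row 0])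
    finally have "?P n s t \<le> 1" .
    moreover have "?P n s t \<ge> 0" using nn 0 \<open>t \<in> S\<close> by (rule matrix_power_nonneg)
    moreover have "1 / real (card S) \<le> 1" "1 / real (card S) \<ge> 0" using cS by (auto simp: divide_simps)
    ultimately have "\<bar>?P n s t - 1 / real (card S)\<bar> \<le> 1" unfolding abs_le_iff by linarith
    then show ?case by simp
  next
    case (Suc q)
    let ?y = "\<lambda>u. ?P (q * m + n) u t - 1 / card S"
    have y0: "(\<Sum>u\<in>S. ?y u) = 0"
      using matrix_power_column_sum[OF \<open>finite S\<close> col \<open>t \<in> S\<close>] cS by (simp add: sum_subtractf)
    have "?P (Suc q * m + n) s t = (\<Sum>u\<in>S. ?P m s u * ?P (q * m + n) u t)"
      using matrix_power_add[OF \<open>finite S\<close> \<open>t \<in> S\<close>, of M m "q * m + n" s] by (simp add: add.assoc)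
    also have "\<dots> = (\<Sum>u\<in>S. (?P m s u - \<delta>) * ?y u + \<delta> * ?y u + ?P m s u * (1 / card S))"
      by (rule sum.cong) (auto simp: algebra_simps)
    also have "\<dots> = (\<Sum>u\<in>S. (?P m s u - \<delta>) * ?y u) + \<delta> * (\<Sum>u\<in>S. ?y u)
        + (\<Sum>u\<in>S. ?P m s u) * (1 / card S)"
      unfolding sum.distrib by (simp only: sum_distrib_left sum_distrib_right)
    finally have "?P (Suc q * m + n) s t - 1 / card S = (\<Sum>u\<in>S. (?P m s u - \<delta>) * ?y u)"
      using y0 matrix_power_row_sum[OF \<open>finite S\<close> row Suc.prems] by simp
    also have "\<bar>\<dots>\<bar> \<le> (\<Sum>u\<in>S. (?P m s u - \<delta>) * \<rho> ^ q)"
    proof (rule order_trans[OF sum_abs sum_mono])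
      fix u assume "u \<in> S"
      then show "\<bar>(?P m s u - \<delta>) * ?y u\<bar> \<le> (?P m s u - \<delta>) * \<rho> ^ q"
        using \<delta>(2) Suc by (auto simp: abs_mult intro!: mult_mono)
    qed
    also have "\<dots> = \<rho> ^ Suc q"
      using excess[OF Suc.prems] by (simp flip: sum_distrib_right)
    finally show ?case .
  qed
  have "(\<lambda>n. ?P n s t - 1 / card S) \<longlonglongrightarrow> 0"
  proof (rule Lim_null_comparison)
    show "\<forall>\<^sub>F n in sequentially. norm (?P n s t - 1 / card S) \<le> \<rho> ^ (n div m)"
      using bound[OF \<open>s \<in> S\<close>, of "n div m" "n mod m" for n] by (auto intro!: always_eventually)
    show "(\<lambda>n. \<rho> ^ (n div m)) \<longlonglongrightarrow> 0"
      using \<open>\<rho> \<ge> 0\<close> \<open>\<rho> < 1\<close> m(1) by (rule power_div_tendsto_0)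
  qed
  then show ?thesis by (simp add: LIM_zero_iff)
qed

section \<open>Follower sets and the Fischer cover\<close>

text \<open>The left quotient of a language by a word. It applies to the nodes themselves, so a walk
  in the Fischer cover becomes an iterated quotient.\<close>

definition residual :: "nat list set \<Rightarrow> nat list \<Rightarrow> nat list set" where
  "residual F w = {v. w @ v \<in> F}"

lemma residual_append: "residual F (u @ v) = residual (residual F u) v"
  by (simp add: residual_def)

lemma residual_Nil [simp]: "residual F [] = F"
  by (simp add: residual_def)

lemma in_residual [simp]: "v \<in> residual F w \<longleftrightarrow> w @ v \<in> F"
  by (simp add: residual_def)

lemma language_cases: "w \<in> language \<Sigma> \<Longrightarrow> \<exists>x n. x \<in> \<Sigma> \<and> w = map x [0..<n]"
  by (auto simp: language_def)

lemma language_appendD1: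
  assumes "u @ v \<in> language \<Sigma>"
  shows "u \<in> language \<Sigma>"
proof -
  obtain x n where x: "x \<in> \<Sigma>" "u @ v = map x [0..<n]"
    using assms by (auto simp: language_def)
  have "length u \<le> n" using arg_cong[OF x(2), of length] by simp
  have "u = take (length u) (map x [0..<n])" using x(2) by (metis append_eq_conv_conj)
  also have "\<dots> = map x [0..<length u]"
    using \<open>length u \<le> n\<close> by (simp add: take_map take_upt)
  finally show ?thesis using x(1) by (auto simp: language_def)
qed

lemma language_appendD2:
  assumes "subshift g \<Sigma>" "u @ v \<in> language \<Sigma>"
  shows "v \<in> language \<Sigma>"
  using assms(2)
proof (induction u)
  case (Cons d u)
  obtain x n where x: "x \<in> \<Sigma>" "d # u @ v = map x [0..<n]"
    using language_cases[OF Cons.prems] unfolding append_Cons by (elim exE conjE) (rule that)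
  have "n \<noteq> 0" using arg_cong[OF x(2), of length] by simp
  then obtain m where [simp]: "n = Suc m" by (rule not0_implies_Suc[THEN exE])
  have "u @ v = map (\<lambda>i. x (Suc i)) [0..<m]"
    using x(2) by (simp add: map_upt_Suc del: upt_Suc)
  moreover have "(\<lambda>i. x (Suc i)) \<in> \<Sigma>"
    using assms(1) x(1) by (auto simp: subshift_def)
  ultimately have "u @ v \<in> language \<Sigma>" by (auto simp: language_def)
  then show ?case by (rule Cons.IH)
qed simp

lemma language_digits: "subshift g \<Sigma> \<Longrightarrow> w \<in> language \<Sigma> \<Longrightarrow> d \<in> set w \<Longrightarrow> d < g"
  unfolding subshift_def language_def by fastforce

lemma follower_eq: "subshift g \<Sigma> \<Longrightarrow> follower \<Sigma> w = residual (language \<Sigma>) w"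
  by (auto simp: follower_def dest: language_appendD2)

text \<open>In a labelled graph the follower set of \<open>w\<close> only depends on the set of vertices in which
  the paths labelled \<open>w\<close> end.\<close>

lemma finite_fischer_nodes:
  assumes "subshift g \<Sigma>" "sofic \<Sigma>"
  shows "finite (fischer_nodes \<Sigma>)"
proof -
  obtain G :: "(nat, nat) pre_digraph" and lab where G: "fin_digraph G"
    "\<Sigma> = {\<lambda>i. lab (e i) | e. \<forall>i. e i \<in> arcs G \<and> head G (e i) = tail G (e (Suc i))}"
    using assms(2) unfolding sofic_def by blast
  interpret fin_digraph G by fact
  define path where "path e \<longleftrightarrow> (\<forall>i. e i \<in> arcs G \<and> head G (e i) = tail G (e (Suc i)))" for e
  \<comment> \<open>Both definitions use infinite paths, because the language consists of initial
    segments of infinite paths: vertices without an infinite continuation never count.\<close>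
  define ends where "ends w = {tail G (e (length w)) | e. path e \<and> w = map (\<lambda>i. lab (e i)) [0..<length w]}" for w
  define spell where "spell T = {map (\<lambda>i. lab (e i)) [0..<n] | e n. path e \<and> tail G (e 0) \<in> T}" for T
  have L: "w \<in> language \<Sigma> \<longleftrightarrow> (\<exists>e. path e \<and> w = map (\<lambda>i. lab (e i)) [0..<length w])" for w
  proof
    assume "w \<in> language \<Sigma>"
    then obtain e n where e: "path e" "w = map (\<lambda>i. lab (e i)) [0..<n]"
      unfolding language_def G(2) path_def by blast
    then have "n = length w" by simp
    with e show "\<exists>e. path e \<and> w = map (\<lambda>i. lab (e i)) [0..<length w]" by (intro exI[of _ e]) simp
  next
    assume "\<exists>e. path e \<and> w = map (\<lambda>i. lab (e i)) [0..<length w]"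
    then obtain e where e: "path e" "w = map (\<lambda>i. lab (e i)) [0..<length w]"
      by (elim exE conjE)
    have "(\<lambda>i. lab (e i)) \<in> \<Sigma>"
      unfolding G(2) using e(1)[unfolded path_def] by (intro CollectI exI[of _ e] conjI refl)
    then show "w \<in> language \<Sigma>" using e(2) unfolding language_def
      by (intro CollectI exI[of _ "\<lambda>i. lab (e i)"] exI[of _ "length w"] conjI)
  qed
  have "follower \<Sigma> w = spell (ends w)" for w
  proof (rule set_eqI)
    fix v
    have "w @ v \<in> language \<Sigma> \<longleftrightarrow> v \<in> spell (ends w)"
    proof
      assume "w @ v \<in> language \<Sigma>"
      then obtain e where e: "path e" "w @ v = map (\<lambda>i. lab (e i)) [0..<length (w @ v)]"
        unfolding L by (elim exE conjE)
      let ?e = "\<lambda>i. e (length w + i)"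
      have nth: "(w @ v) ! i = lab (e i)" if "i < length (w @ v)" for i
        by (subst e(2)) (use that in simp)
      have "w = map (\<lambda>i. lab (e i)) [0..<length w]"
      proof (rule nth_equalityI)
        fix i assume "i < length w"
        then show "w ! i = map (\<lambda>i. lab (e i)) [0..<length w] ! i"
          using nth[of i] by (simp add: nth_append)
      qed simp
      then have "tail G (?e 0) \<in> ends w" using e(1) by (auto simp: ends_def)
      moreover have "path ?e" using e(1) by (simp add: path_def)
      moreover have "v = map (\<lambda>i. lab (?e i)) [0..<length v]"
        by (rule nth_equalityI) (use nth[of "length w + i" for i] in auto)
      ultimately show "v \<in> spell (ends w)" 
        unfolding spell_def by (intro CollectI exI[of _ ?e] exI[of _ "length v"] conjI)
    next
      assume "v \<in> spell (ends w)"
      then obtain e n e' where e: "path e" "v = map (\<lambda>i. lab (e i)) [0..<n]" "path e'"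
        "tail G (e 0) = tail G (e' (length w))" "w = map (\<lambda>i. lab (e' i)) [0..<length w]"
        unfolding spell_def ends_def by auto
      \<comment> \<open>Follow \<open>e'\<close> along \<open>w\<close> and switch to
        \<open>e\<close> at their common vertex.\<close>
      define h where "h i = (if i < length w then e' i else e (i - length w))" for i
      have "path h"
        unfolding path_def
      proof (intro allI conjI)
        fix i show "h i \<in> arcs G" using e(1,3) by (auto simp: h_def path_def)
        show "head G (h i) = tail G (h (Suc i))"
        proof (cases "Suc i = length w")
          case True
          then show ?thesis using e(1,3,4) by (auto simp: h_def path_def)
        next
          case False
          then show ?thesis using e(1,3) by (auto simp: h_def path_def Suc_diff_le)
        qed
      qed
      moreover have "w ! i = lab (e' i)" if "i < length w" for i
        by (subst e(5)) (use that in simp)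
      then have "w @ v = map (\<lambda>i. lab (h i)) [0..<length (w @ v)]"
        using e(2) by (intro nth_equalityI) (auto simp: h_def nth_append)
      ultimately show "w @ v \<in> language \<Sigma>" unfolding L by (intro exI conjI)
    qed
    then show "v \<in> follower \<Sigma> w \<longleftrightarrow> v \<in> spell (ends w)"
      using follower_eq[OF assms(1)] by auto
  qed
  moreover have "ends w \<in> Pow (verts G)" for w
    unfolding ends_def path_def by auto
  ultimately have "fischer_nodes \<Sigma> \<subseteq> spell ` Pow (verts G)"
    unfolding fischer_nodes_def by blast
  then show ?thesis by (rule finite_subset) simp
qed

section \<open>The Fischer cover of a regular shift as a deterministic automaton\<close>

locale regular_shift =
  fixes g k :: nat and \<Sigma> :: "(nat \<Rightarrow> nat) set"
  assumes subshift: "subshift g \<Sigma>" and regular: "k_regular g k \<Sigma>" and k_ge_2: "k \<ge> 2"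
    and ex_sync: "\<exists>w. synchronizing \<Sigma> w"
begin

abbreviation "L \<equiv> language \<Sigma>"
abbreviation "V \<equiv> fischer_nodes \<Sigma>"

lemmas L_appendD1 = language_appendD1[of _ _ \<Sigma>]
lemmas L_appendD2 = language_appendD2[OF subshift]

lemma g_pos: "g > 0"
  using subshift by (auto simp: subshift_def intro!: gr0I)

lemma L_connect: "u \<in> L \<Longrightarrow> v \<in> L \<Longrightarrow> \<exists>x. u @ x @ v \<in> L"
  using regular unfolding k_regular_def transitive_shift_def by blast

lemma V_eq: "V = {residual L w | w. synchronizing \<Sigma> w}"
  by (simp add: fischer_nodes_def follower_eq[OF subshift])

lemma finite_V: "finite V"
  using finite_fischer_nodes[OF subshift] regular by (simp add: k_regular_def)

lemma V_nonempty: "V \<noteq> {}"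
  using ex_sync by (auto simp: V_eq)

lemma card_V_pos: "card V > 0"
  using finite_V V_nonempty by (simp add: card_gt_0_iff)

lemma synchronizing_iff:
  "synchronizing \<Sigma> w \<longleftrightarrow> w \<in> L \<and> (\<forall>u v. u @ w \<in> L \<longrightarrow> w @ v \<in> L \<longrightarrow> u @ w @ v \<in> L)"
  unfolding synchronizing_def using L_appendD1 L_appendD2 by blast

text \<open>The inner \<open>w\<close> already glues whatever precedes it, here
  \<open>u @ x\<close>, to whatever follows it, here \<open>y @ v\<close>.\<close>

lemma synchronizing_append:
  assumes "synchronizing \<Sigma> w" "x @ w @ y \<in> L"
  shows "synchronizing \<Sigma> (x @ w @ y)"
  unfolding synchronizing_iff
proof (intro conjI allI impI)
  fix u v assume *: "u @ x @ w @ y \<in> L" "(x @ w @ y) @ v \<in> L"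
  have "(u @ x) @ w \<in> L" using *(1) L_appendD1[of "u @ x @ w" y] by simp
  moreover have "w @ y @ v \<in> L" using *(2) L_appendD2[of x] by simp
  ultimately have "(u @ x) @ w @ y @ v \<in> L" using assms(1) unfolding synchronizing_iff by blast
  then show "u @ (x @ w @ y) @ v \<in> L" by simp
qed (fact assms(2))

lemma node_cases:
  assumes "F \<in> V"
  obtains s where "synchronizing \<Sigma> s" "F = residual L s"
  using assms by (auto simp: V_eq)

lemma node_subset: "F \<in> V \<Longrightarrow> F \<subseteq> L"
  by (auto simp: V_eq dest: L_appendD2)

lemma Nil_in_node: "F \<in> V \<Longrightarrow> [] \<in> F"
  by (auto simp: V_eq synchronizing_def)

lemma node_appendD1: "F \<in> V \<Longrightarrow> u @ v \<in> F \<Longrightarrow> u \<in> F"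
  by (auto simp: V_eq dest: L_appendD1[of "w @ u" v for w, simplified])

lemma node_Cons: "F \<in> V \<Longrightarrow> d # w \<in> F \<Longrightarrow> [d] \<in> F"
  using node_appendD1[of F "[d]" w] by simp

lemma residual_node:
  assumes "F \<in> V" "w \<in> F"
  shows "residual F w \<in> V"
proof -
  obtain s where s: "synchronizing \<Sigma> s" "F = residual L s" using assms by (rule_tac node_cases)
  then have "synchronizing \<Sigma> (s @ w)" using synchronizing_append[of s "[]" w] assms by simp
  then show ?thesis by (auto simp: V_eq s(2) simp flip: residual_append)
qed

text \<open>The word \<open>w\<close> that witnesses an arc need not be synchronizing, but the
  follower set of \<open>w @ [d]\<close> depends only on that of \<open>w\<close>. So an arc is
  determined by its initial node and its label, and the quotient is again a node because
  synchronizing words remain so when extended.\<close>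

lemma arcs_fischer_cover:
  "arcs (fischer_cover \<Sigma>) = {(F, d, residual F [d]) | F d. F \<in> V \<and> [d] \<in> F}"
proof (intro equalityI subsetI)
  fix e assume "e \<in> arcs (fischer_cover \<Sigma>)"
  then show "e \<in> {(F, d, residual F [d]) | F d. F \<in> V \<and> [d] \<in> F}"
    by (auto simp: fischer_cover_def follower_eq[OF subshift] residual_append)
next
  fix e assume "e \<in> {(F, d, residual F [d]) | F d. F \<in> V \<and> [d] \<in> F}"
  then obtain F d where e: "e = (F, d, residual F [d])" "F \<in> V" "[d] \<in> F" by auto
  obtain s where s: "synchronizing \<Sigma> s" "F = residual L s" using e(2) by (rule node_cases)
  have "s \<in> L" "s @ [d] \<in> L" using s e(3) by (auto simp: synchronizing_def)
  moreover have "residual F [d] = residual L (s @ [d])" by (simp add: s residual_append)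
  ultimately show "e \<in> arcs (fischer_cover \<Sigma>)"
    using e s(2) residual_node[OF e(2,3)]
    by (auto simp: fischer_cover_def follower_eq[OF subshift])
qed

lemma fischer_path_iff:
  "fischer_path \<Sigma> F w F' \<longleftrightarrow> F \<in> V \<and> w \<in> F \<and> F' = residual F w"
proof (induction w arbitrary: F)
  case Nil
  show ?case
    by (auto simp: fischer_path_def pre_digraph.awalk_def pre_digraph.cas.simps)
      (auto simp: fischer_cover_def dest: Nil_in_node)
next
  case (Cons d w)
  have "fischer_path \<Sigma> F (d # w) F' \<longleftrightarrow> (F \<in> V \<and> [d] \<in> F \<and> fischer_path \<Sigma> (residual F [d]) w F')"
  proof
    assume "fischer_path \<Sigma> F (d # w) F'"
    then obtain e es where e: "pre_digraph.awalk (fischer_cover \<Sigma>) F (e # es) F'"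
      "fischer_label e = d" "map fischer_label es = w"
      by (auto simp: fischer_path_def)
    then have "e \<in> arcs (fischer_cover \<Sigma>)" "tail (fischer_cover \<Sigma>) e = F"
      by (auto simp: pre_digraph.awalk_def pre_digraph.cas.simps)
    then have *: "F \<in> V" "[d] \<in> F" "e = (F, d, residual F [d])"
      using e(2) unfolding arcs_fischer_cover by (auto simp: fischer_label_def fischer_cover_def)
    then have "pre_digraph.awalk (fischer_cover \<Sigma>) (residual F [d]) es F'"
      using e(1) residual_node[OF *(1,2)]
      by (auto simp: pre_digraph.awalk_def pre_digraph.cas.simps fischer_cover_def)
    with * e(3) show "F \<in> V \<and> [d] \<in> F \<and> fischer_path \<Sigma> (residual F [d]) w F'"
      by (auto simp: fischer_path_def)
  next
    assume *: "F \<in> V \<and> [d] \<in> F \<and> fischer_path \<Sigma> (residual F [d]) w F'"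
    then obtain es where es: "pre_digraph.awalk (fischer_cover \<Sigma>) (residual F [d]) es F'"
      "map fischer_label es = w" by (auto simp: fischer_path_def)
    let ?e = "(F, d, residual F [d])"
    have "?e \<in> arcs (fischer_cover \<Sigma>)" using * by (auto simp: arcs_fischer_cover)
    then have "pre_digraph.awalk (fischer_cover \<Sigma>) F (?e # es) F'"
      using es(1) * by (auto simp: pre_digraph.awalk_def pre_digraph.cas.simps)
        (auto simp: fischer_cover_def)
    moreover have "map fischer_label (?e # es) = d # w" using es(2) by (simp add: fischer_label_def)
    ultimately show "fischer_path \<Sigma> F (d # w) F'"
      unfolding fischer_path_def by (intro exI[of _ "?e # es"] conjI)
  qed
  also have "\<dots> \<longleftrightarrow> F \<in> V \<and> d # w \<in> F \<and> F' = residual F (d # w)"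
    using residual_append[of F "[d]" w] node_appendD1[of F "[d]" w] residual_node[of F "[d]"]
    by (auto simp: Cons.IH)
  finally show ?case .
qed

lemma out_degree:
  assumes "F \<in> V"
  shows "finite {d. [d] \<in> F}" "card {d. [d] \<in> F} = k"
proof -
  let ?f = "\<lambda>d. (F, d, residual F [d])"
  have "out_arcs (fischer_cover \<Sigma>) F = ?f ` {d. [d] \<in> F}"
    using assms unfolding out_arcs_def arcs_fischer_cover by (auto simp: fischer_cover_def)
  moreover have "F \<in> verts (fischer_cover \<Sigma>)" using assms by (simp add: fischer_cover_def)
  then have "finite (out_arcs (fischer_cover \<Sigma>) F)" "card (out_arcs (fischer_cover \<Sigma>) F) = k"
    using regular by (auto simp: k_regular_def out_degree_def)
  moreover have "inj_on ?f {d. [d] \<in> F}" by (auto intro: inj_onI)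
  ultimately show "finite {d. [d] \<in> F}" "card {d. [d] \<in> F} = k"
    by (auto simp: card_image dest: finite_imageD)
qed

lemma in_degree:
  assumes "F' \<in> V"
  shows "finite {(F, d). F \<in> V \<and> [d] \<in> F \<and> residual F [d] = F'}"
    "card {(F, d). F \<in> V \<and> [d] \<in> F \<and> residual F [d] = F'} = k"
proof -
  let ?A = "{(F, d). F \<in> V \<and> [d] \<in> F \<and> residual F [d] = F'}"
  let ?f = "\<lambda>(F, d). (F, d, residual F [d])"
  have "in_arcs (fischer_cover \<Sigma>) F' = ?f ` ?A"
    unfolding in_arcs_def arcs_fischer_cover by (auto simp: fischer_cover_def)
  moreover have "F' \<in> verts (fischer_cover \<Sigma>)" using assms by (simp add: fischer_cover_def)
  then have "finite (in_arcs (fischer_cover \<Sigma>) F')" "card (in_arcs (fischer_cover \<Sigma>) F') = k"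
    using regular by (auto simp: k_regular_def in_degree_def)
  moreover have "inj_on ?f ?A" by (auto intro: inj_onI)
  ultimately show "finite ?A" "card ?A = k"
    by (auto simp: card_image dest: finite_imageD)
qed

section \<open>Counting paths in the Fischer cover\<close>

definition node_words :: "nat list set \<Rightarrow> nat \<Rightarrow> nat list set" where
  "node_words F n = {w \<in> F. length w = n}"

lemma finite_length_L: "finite {w \<in> L. length w = n}"
proof (rule finite_subset)
  show "{w \<in> L. length w = n} \<subseteq> {w. set w \<subseteq> {..<g} \<and> length w = n}"
    using language_digits[OF subshift] by auto
  show "finite {w. set w \<subseteq> {..<g} \<and> length w = n}"
    by (rule finite_lists_length_eq) simp
qed

lemma finite_node_words: "F \<in> V \<Longrightarrow> finite (node_words F n)"
  unfolding node_words_def by (rule finite_subset[OF _ finite_length_L[of n]]) (auto dest: node_subset)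

lemma card_node_words: "F \<in> V \<Longrightarrow> card (node_words F n) = k ^ n"
proof (induction n arbitrary: F)
  case 0
  have "node_words F 0 = {[]}" using Nil_in_node[OF 0] by (auto simp: node_words_def)
  then show ?case by simp
next
  case (Suc n)
  let ?D = "{d. [d] \<in> F}"
  have node: "residual F [d] \<in> V" if "[d] \<in> F" for d using residual_node[OF Suc.prems that] .
  have "bij_betw (\<lambda>(d, w). d # w) (SIGMA d:?D. node_words (residual F [d]) n) (node_words F (Suc n))"
    by (rule bij_betw_byWitness[where f' = "\<lambda>w. (hd w, tl w)"])
      (auto simp: node_words_def length_Suc_conv node_Cons[OF Suc.prems])
  then have "card (node_words F (Suc n)) = card (SIGMA d:?D. node_words (residual F [d]) n)"
    by (simp add: bij_betw_same_card)
  also have "\<dots> = (\<Sum>d\<in>?D. card (node_words (residual F [d]) n))"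
    using out_degree(1)[OF Suc.prems] finite_node_words node by (intro card_SigmaI) auto
  also have "\<dots> = (\<Sum>d\<in>?D. k ^ n)" by (rule sum.cong) (auto simp: Suc.IH node)
  finally show ?case using out_degree(2)[OF Suc.prems] by simp
qed

text \<open>The initial node is kept beside the word, since one word may lead to \<open>F'\<close>
  from several nodes. These pairs are what the column sums of the matrices count.\<close>

definition incoming :: "nat list set \<Rightarrow> nat \<Rightarrow> (nat list set \<times> nat list) set" where
  "incoming F' n = {(F, w). F \<in> V \<and> w \<in> node_words F n \<and> residual F w = F'}"

lemma finite_incoming: "finite (incoming F' n)"
  by (rule finite_subset[of _ "SIGMA F:V. node_words F n"])
    (auto simp: incoming_def finite_V finite_node_words)

lemma card_incoming: "F' \<in> V \<Longrightarrow> card (incoming F' n) = k ^ n"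
proof (induction n)
  case 0
  have "incoming F' 0 = {(F', [])}"
    using Nil_in_node[OF 0] 0 by (auto simp: incoming_def node_words_def)
  then show ?case by simp
next
  case (Suc n)
  let ?I = "\<lambda>G. {(F, d). F \<in> V \<and> [d] \<in> F \<and> residual F [d] = G}"
  let ?S = "SIGMA (G, w):incoming F' n. ?I G"
  have res: "residual (residual F [d]) w = residual F (d # w)" for F d w
    using residual_append[of F "[d]" w] by simp
  have "bij_betw (\<lambda>((G, w), (F, d)). (F, d # w)) ?S (incoming F' (Suc n))"
    by (rule bij_betw_byWitness[where f' = "\<lambda>(F, w). ((residual F [hd w], tl w), (F, hd w))"])
      (auto simp: incoming_def node_words_def length_Suc_conv res node_Cons residual_node)
  then have "card (incoming F' (Suc n)) = card ?S" by (simp add: bij_betw_same_card)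
  also have "\<dots> = (\<Sum>(G, w)\<in>incoming F' n. card (?I G))"
    using finite_incoming in_degree(1) by (subst card_SigmaI) (auto simp: incoming_def case_prod_beta)
  also have "\<dots> = (\<Sum>(G, w)\<in>incoming F' n. k)"
    by (rule sum.cong) (auto simp: incoming_def in_degree(2))
  finally show ?case using Suc by simp
qed

text \<open>Transitivity places a synchronizing word somewhere before \<open>v\<close>; everything
  preceding \<open>v\<close> is then synchronizing, and its follower set contains
  \<open>v\<close>.\<close>

lemma L_node:
  assumes "v \<in> L"
  obtains F where "F \<in> V" "v \<in> F"
proof -
  obtain s where s: "synchronizing \<Sigma> s" using ex_sync by blast
  then obtain x where x: "s @ x @ v \<in> L"
    using assms L_connect unfolding synchronizing_def by blast
  have "synchronizing \<Sigma> (s @ x)"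
    using synchronizing_append[of s "[]" x] s L_appendD1[of "s @ x" v] x by simp
  then show ?thesis using that[of "residual L (s @ x)"] x by (auto simp: V_eq)
qed

text \<open>The admissible blocks of \<open>n\<close> low digits below the fixed high digits
  \<open>v\<close>.\<close>

definition L_words :: "nat list \<Rightarrow> nat \<Rightarrow> nat list set" where
  "L_words v n = {u. length u = n \<and> u @ v \<in> L}"

lemma finite_L_words: "finite (L_words v n)"
  by (rule finite_subset[OF _ finite_length_L[of n]]) (auto simp: L_words_def dest: L_appendD1)

lemma card_L_words_le: "card (L_words v n) \<le> card V * k ^ n"
proof -
  have "L_words v n \<subseteq> (\<Union>F\<in>V. node_words F n)"
    by (auto simp: L_words_def node_words_def dest: L_appendD1 elim: L_node)
  then have "card (L_words v n) \<le> card (\<Union>F\<in>V. node_words F n)"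
    by (intro card_mono) (auto simp: finite_V finite_node_words)
  also have "\<dots> \<le> (\<Sum>F\<in>V. card (node_words F n))" by (rule card_UN_le[OF finite_V])
  finally show ?thesis by (simp add: card_node_words)
qed

lemma card_L_words_Nil_ge: "card (L_words [] n) \<ge> k ^ n"
proof -
  obtain F where "F \<in> V" using V_nonempty by blast
  then have "node_words F n \<subseteq> L_words [] n"
    using node_subset by (auto simp: node_words_def L_words_def)
  from card_mono[OF finite_L_words this] show ?thesis using card_node_words[OF \<open>F \<in> V\<close>] by simp
qed

text \<open>By transitivity some \<open>x @ s\<close> with \<open>s\<close> synchronizing can be
  read from \<open>F\<close>. It can be prolonged to any length because every node has outgoing
  edges, and it stays synchronizing. As all large lengths work, the finitely many nodes share
  one.\<close>

lemma eventually_sync_word: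
  assumes "F \<in> V"
  shows "eventually (\<lambda>n. \<exists>w\<in>node_words F n. synchronizing \<Sigma> w) sequentially"
proof -
  obtain s where s: "synchronizing \<Sigma> s" "F = residual L s" using assms by (rule node_cases)
  then obtain x where x: "s @ x @ s \<in> L"
    using L_connect unfolding synchronizing_def by blast
  then have "x @ s \<in> F" by (simp add: s)
  have "\<exists>w\<in>node_words F n. synchronizing \<Sigma> w" if "n \<ge> length (x @ s)" for n
  proof -
    have "card (node_words (residual F (x @ s)) (n - length (x @ s))) \<noteq> 0"
      using card_node_words[OF residual_node[OF assms \<open>x @ s \<in> F\<close>]] k_ge_2 by simp
    then have "node_words (residual F (x @ s)) (n - length (x @ s)) \<noteq> {}" by force
    then obtain y where y: "x @ s @ y \<in> F" "length y = n - length (x @ s)"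
      by (auto simp: node_words_def)
    then have "synchronizing \<Sigma> (x @ s @ y)"
      using synchronizing_append[OF s(1)] node_subset[OF assms] by auto
    then show ?thesis using y that by (intro bexI[of _ "x @ s @ y"]) (auto simp: node_words_def)
  qed
  then show ?thesis unfolding eventually_sequentially by blast
qed

text \<open>Every node has a synchronizing word of a common length \<open>m\<close>, so each block of \<open>m\<close> letters
  loses at least one of the \<open>k\<^sup>m\<close> words when synchronizing words are avoided.\<close>

lemma nonsync_density:
  "(\<lambda>n. card {u \<in> L. length u = n \<and> \<not> synchronizing \<Sigma> u} / k ^ n) \<longlonglongrightarrow> 0"
proof -
  define B where "B F n = {w \<in> node_words F n. \<not> synchronizing \<Sigma> w}" for F n
  have fin: "finite (B F n)" if "F \<in> V" for F n
    using finite_node_words[OF that] by (simp add: B_def)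
  have "eventually (\<lambda>n. \<forall>F\<in>V. \<exists>w\<in>node_words F n. synchronizing \<Sigma> w) sequentially"
    by (intro eventually_ball_finite finite_V ballI eventually_sync_word)
  then obtain m where m: "m \<ge> 1" "\<And>F. F \<in> V \<Longrightarrow> \<exists>w\<in>node_words F m. synchronizing \<Sigma> w"
    unfolding eventually_sequentially by (metis nat_le_linear)
  have Bm: "card (B F m) \<le> k ^ m - 1" if "F \<in> V" for F
  proof -
    have "B F m \<subset> node_words F m" using m(2)[OF that] by (auto simp: B_def)
    then have "card (B F m) < k ^ m"
      using psubset_card_mono[OF finite_node_words[OF that]] card_node_words[OF that] by metis
    then show ?thesis by simp
  qed
  have bound: "card (B F (q * m + n)) \<le> (k ^ m - 1) ^ q * k ^ n" if "F \<in> V" for F q n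
    using that
  proof (induction q arbitrary: F)
    case 0
    have "B F n \<subseteq> node_words F n" by (auto simp: B_def)
    then show ?case using card_mono[OF finite_node_words[OF 0]] card_node_words[OF 0] by auto
  next
    case (Suc q)
    have node: "residual F u \<in> V" if "u \<in> B F m" for u
      using that residual_node[OF Suc.prems] by (auto simp: B_def node_words_def)
    \<comment> \<open>A word with a synchronizing factor is synchronizing, so both the first block
      and the rest avoid synchronizing words.\<close>
    have sub: "B F (Suc q * m + n) \<subseteq> (\<Union>u\<in>B F m. (@) u ` B (residual F u) (q * m + n))"
    proof
      fix w assume w: "w \<in> B F (Suc q * m + n)"
      define u v where "u = take m w" and "v = drop m w"
      have uv: "w = u @ v" by (simp add: u_def v_def)
      have len: "length u = m" "length v = q * m + n"
        using w by (auto simp: B_def node_words_def u_def v_def)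
      have wL: "u @ v \<in> L" "u @ v \<in> F"
        using w uv node_subset[OF Suc.prems] by (auto simp: B_def node_words_def)
      have "\<not> synchronizing \<Sigma> u" "\<not> synchronizing \<Sigma> v"
        using w uv synchronizing_append[of u "[]" v] synchronizing_append[of v u "[]"] wL
        by (auto simp: B_def)
      then show "w \<in> (\<Union>u\<in>B F m. (@) u ` B (residual F u) (q * m + n))"
        using len wL(2) node_appendD1[OF Suc.prems wL(2)] uv
        by (auto simp: B_def node_words_def intro!: bexI[of _ u])
    qed
    have "card (B F (Suc q * m + n)) \<le> card (\<Union>u\<in>B F m. (@) u ` B (residual F u) (q * m + n))"
      using fin[OF Suc.prems] fin[OF node] by (intro card_mono[OF _ sub]) auto
    also have "\<dots> \<le> (\<Sum>u\<in>B F m. card ((@) u ` B (residual F u) (q * m + n)))"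
      by (rule card_UN_le[OF fin[OF Suc.prems]])
    also have "\<dots> \<le> (\<Sum>u\<in>B F m. (k ^ m - 1) ^ q * k ^ n)"
      by (intro sum_mono order_trans[OF card_image_le] fin node Suc.IH)
    also have "\<dots> \<le> (k ^ m - 1) * ((k ^ m - 1) ^ q * k ^ n)"
      using Bm[OF Suc.prems] by simp
    finally show ?case by (simp add: mult.assoc)
  qed
  \<comment> \<open>The largest proportion of the words of one block that can fail to be
    synchronizing.\<close>
  define \<rho> where "\<rho> = (real k ^ m - 1) / real k ^ m"
  have km: "real k ^ m \<ge> 1" using k_ge_2 by simp
  have \<rho>: "0 \<le> \<rho>" "\<rho> < 1" using km by (auto simp: \<rho>_def divide_simps)
  have le: "card {u \<in> L. length u = n \<and> \<not> synchronizing \<Sigma> u} / k ^ n \<le> card V * \<rho> ^ (n div m)" for n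
  proof -
    have "{u \<in> L. length u = n \<and> \<not> synchronizing \<Sigma> u} \<subseteq> (\<Union>F\<in>V. B F n)"
      by (auto simp: B_def node_words_def elim: L_node)
    then have "card {u \<in> L. length u = n \<and> \<not> synchronizing \<Sigma> u} \<le> card (\<Union>F\<in>V. B F n)"
      by (intro card_mono) (auto simp: finite_V fin)
    also have "\<dots> \<le> (\<Sum>F\<in>V. card (B F n))" by (rule card_UN_le[OF finite_V])
    also have "\<dots> \<le> (\<Sum>F\<in>V. (k ^ m - 1) ^ (n div m) * k ^ (n mod m))"
      using bound[of _ "n div m" "n mod m"] by (intro sum_mono) simp
    finally have "card {u \<in> L. length u = n \<and> \<not> synchronizing \<Sigma> u}
        \<le> card V * ((k ^ m - 1) ^ (n div m) * k ^ (n mod m))" by simp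
    then have "real (card {u \<in> L. length u = n \<and> \<not> synchronizing \<Sigma> u})
        \<le> real (card V * ((k ^ m - 1) ^ (n div m) * k ^ (n mod m)))"
      by (simp only: of_nat_le_iff)
    also have "\<dots> = card V * ((real k ^ m - 1) ^ (n div m) * real k ^ (n mod m))"
      using k_ge_2 by (simp add: of_nat_diff)
    also have "real k ^ n = (real k ^ m) ^ (n div m) * real k ^ (n mod m)"
      by (simp flip: power_mult power_add)
    ultimately show ?thesis
      using k_ge_2 by (simp add: \<rho>_def power_divide field_simps)
  qed
  show ?thesis
  proof (rule Lim_null_comparison)
    show "\<forall>\<^sub>F n in sequentially. norm (card {u \<in> L. length u = n \<and> \<not> synchronizing \<Sigma> u} / k ^ n)
        \<le> card V * \<rho> ^ (n div m)"
      using le by simp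
    show "(\<lambda>n. card V * \<rho> ^ (n div m)) \<longlonglongrightarrow> 0"
      by (rule tendsto_mult_right_zero[OF power_div_tendsto_0[OF \<rho> m(1)]])
  qed
qed

end

section \<open>Equidistribution on words\<close>

lemma cong_tuple_add_left:
  "cong_tuple r a (\<lambda>j. x j + y j) c \<longleftrightarrow> cong_tuple r a y (\<lambda>j. c j - x j)"
  by (simp add: cong_tuple_def cong_iff_dvd_diff algebra_simps)

lemma cong_tuple_trans_left:
  "cong_tuple r a x y \<Longrightarrow> cong_tuple r a x c \<longleftrightarrow> cong_tuple r a y c"
  unfolding cong_tuple_def by (meson cong_sym cong_trans)

text \<open>The canonical representative in \<open>residue_tuples\<close>. The restriction fixes the
  value outside \<open>{1..r}\<close>, so that congruence of tuples becomes equality of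
  functions.\<close>

definition residue :: "nat \<Rightarrow> (nat \<Rightarrow> nat) \<Rightarrow> (nat \<Rightarrow> int) \<Rightarrow> nat \<Rightarrow> int" where
  "residue r a x = (\<lambda>j\<in>{1..r}. x j mod int (a j))"

lemma residue_eq_iff: "residue r a x = residue r a y \<longleftrightarrow> cong_tuple r a x y"
  unfolding residue_def cong_tuple_def cong_def by (auto simp: fun_eq_iff restrict_def)

lemma residue_id: "x \<in> residue_tuples r a \<Longrightarrow> residue r a x = x"
  unfolding residue_def residue_tuples_def by (auto simp: PiE_iff extensional_def fun_eq_iff)

lemma card_residue_tuples: "card (residue_tuples r a) = (\<Prod>j=1..r. a j)"
  unfolding residue_tuples_def by (simp add: card_PiE)

lemma finite_residue_tuples: "finite (residue_tuples r a)"
  unfolding residue_tuples_def by (intro finite_PiE) auto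

lemma sum_card_fibres:
  assumes "finite A" "finite T" "h ` A \<subseteq> T"
  shows "(\<Sum>t\<in>T. card {x \<in> A. h x = t}) = card A"
  using sum.group[OF assms, of "\<lambda>_. 1::nat"] by simp

section \<open>Digit weights and the Markov matrices\<close>

locale weighted_shift = regular_shift +
  fixes r :: nat and a :: "nat \<Rightarrow> nat" and f :: "nat \<Rightarrow> nat \<Rightarrow> int" and p l :: nat
  assumes a_pos: "\<And>j. j \<in> {1..r} \<Longrightarrow> a j \<ge> 1"
    and additive: "\<And>j. j \<in> {1..r} \<Longrightarrow> g_additive g (f j)"
    and period: "eventual_period g r a f p l"
    and markov: "markov_condition g r a f \<Sigma> k p l"
begin

abbreviation "R \<equiv> residue_tuples r a"
abbreviation "S \<equiv> states r a \<Sigma>"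
abbreviation "congr \<equiv> cong_tuple r a"

text \<open>The digitwise form of \<open>f j (g ^ i * word_val g w)\<close>, see
  \<open>f_word_val\<close>. It splits over concatenation for arbitrary lists, whereas additivity of
  \<open>f j\<close> speaks only of digits below \<open>g\<close>.\<close>

definition weight :: "nat \<Rightarrow> nat list \<Rightarrow> nat \<Rightarrow> int" where
  "weight i w j = (\<Sum>t<length w. f j (w ! t * g ^ (i + t)))"

lemma p_pos: "p \<ge> 1"
  using period by (simp add: eventual_period_def)

lemma residue_in_R: "residue r a x \<in> R"
proof -
  have "x j mod int (a j) < int (a j)" "0 \<le> x j mod int (a j)" if "j \<in> {1..r}" for j
    using a_pos[OF that] by auto
  then show ?thesis unfolding residue_def residue_tuples_def by auto
qed

lemma card_R_pos: "card R > 0"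
  using finite_residue_tuples residue_in_R by (auto simp: card_gt_0_iff)

lemma congr_diff_iff: "c \<in> R \<Longrightarrow> congr y (\<lambda>j. c j - x j) \<longleftrightarrow> residue r a (\<lambda>j. x j + y j) = c"
  using cong_tuple_add_left[of r a x y c] residue_eq_iff[of r a "\<lambda>j. x j + y j" c] residue_id[of c]
  by simp

lemma weight_snoc: "weight i (w @ [d]) j = weight i w j + f j (d * g ^ (i + length w))"
  unfolding weight_def by (simp add: nth_append)

lemma weight_append: "weight i (u @ v) j = weight i u j + weight (i + length u) v j"
proof (induction v rule: rev_induct)
  case Nil
  show ?case by (simp add: weight_def)
next
  case (snoc d v)
  have "weight i (u @ v @ [d]) j = weight i (u @ v) j + f j (d * g ^ (i + length (u @ v)))"
    using weight_snoc[of i "u @ v" d j] by simp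
  with snoc show ?case by (simp add: weight_snoc add.assoc)
qed

lemma weight_periodic:
  assumes "i \<ge> l" "\<And>d. d \<in> set w \<Longrightarrow> d < g"
  shows "congr (weight (i + n * p) w) (weight i w)"
  unfolding cong_tuple_def weight_def
proof (intro ballI cong_sum)
  fix j t assume j: "j \<in> {1..r}" and "t \<in> {..<length w}"
  then have "w ! t < g" using assms(2) by simp
  then have "[f j (w ! t * g ^ ((i + t) + n * p)) = f j (w ! t * g ^ (i + t))] (mod int (a j))"
    using period assms(1) j unfolding eventual_period_def cong_tuple_def by (cases "n = 0") auto
  then show "[f j (w ! t * g ^ (i + n * p + t)) = f j (w ! t * g ^ (i + t))] (mod int (a j))"
    by (simp add: add_ac)
qed

lemma f_word_val:
  assumes j: "j \<in> {1..r}" and w: "\<And>d. d \<in> set w \<Longrightarrow> d < g"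
  shows "f j (g ^ i * word_val g w) = weight i w j"
proof -
  define m where "m = i + length w"
  \<comment> \<open>The factor \<open>g ^ i\<close> becomes \<open>i\<close> leading zero digits.
    The digit at \<open>m\<close> is a zero as well, since the sums in \<open>g_additive\<close>
    include their upper index.\<close>
  define x where "x t = (if t < i \<or> m \<le> t then 0 else w ! (t - i))" for t
  have xg: "x t < g" for t using w g_pos by (auto simp: x_def m_def)
  have f: "f j (\<Sum>t\<le>n. y t * g ^ t) = (\<Sum>t\<le>n. f j (y t * g ^ t))" if "\<And>t. y t < g" for n y
    using additive[OF j] that unfolding g_additive_def by blast
  \<comment> \<open>With two zero digits additivity reads
    \<open>f j 0 = f j 0 + f j 0\<close>.\<close>
  have f0: "f j 0 = 0" using f[of "\<lambda>_. 0" 1] g_pos by simp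
  have shift: "(\<Sum>t\<le>m. \<psi> t) = (\<Sum>t<length w. \<psi> (t + i))"
    if "\<And>t. t < i \<or> m \<le> t \<Longrightarrow> \<psi> t = 0" for \<psi> :: "nat \<Rightarrow> 'x :: comm_monoid_add"
  proof -
    have "(\<Sum>t\<le>m. \<psi> t) = (\<Sum>t\<in>{0+i..<length w+i}. \<psi> t)"
      by (rule sum.mono_neutral_right) (auto intro!: that simp: m_def)
    then show ?thesis by (simp only: sum.shift_bounds_nat_ivl lessThan_atLeast0)
  qed
  have "g ^ i * word_val g w = (\<Sum>t<length w. x (t + i) * g ^ (t + i))"
    unfolding word_val_def sum_distrib_left
    by (rule sum.cong) (auto simp: x_def m_def power_add)
  also have "\<dots> = (\<Sum>t\<le>m. x t * g ^ t)" by (rule shift[symmetric]) (simp add: x_def)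
  finally have "f j (g ^ i * word_val g w) = (\<Sum>t\<le>m. f j (x t * g ^ t))" using f[OF xg] by simp
  also have "\<dots> = (\<Sum>t<length w. f j (x (t + i) * g ^ (t + i)))"
    by (rule shift) (simp add: x_def f0)
  also have "\<dots> = weight i w j"
    unfolding weight_def by (rule sum.cong) (auto simp: x_def m_def add.commute)
  finally show ?thesis .
qed

text \<open>\<open>E_words\<close> with the length set free: at length \<open>n * p\<close> these
  sets describe the \<open>n\<close>-th power of the matrix.\<close>

definition trans_words :: "nat list set \<Rightarrow> nat list set \<Rightarrow> nat \<Rightarrow> nat \<Rightarrow> (nat \<Rightarrow> int) \<Rightarrow> nat list set" where
  "trans_words F F' n i c = {w \<in> node_words F n. residual F w = F' \<and> congr (weight i w) c}"

lemma E_words_eq: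
  assumes "F \<in> V"
  shows "E_words g r a f \<Sigma> p i c F F' = trans_words F F' p i c"
proof -
  have "congr (\<lambda>j. f j (g ^ i * word_val g w)) c \<longleftrightarrow> congr (weight i w) c" if "w \<in> L" for w
    using f_word_val[OF _ language_digits[OF subshift that]] by (simp add: cong_tuple_def)
  then show ?thesis
    using assms node_subset[OF assms]
    by (auto simp: E_words_def trans_words_def node_words_def language_n_def fischer_path_iff)
qed

lemma finite_S: "finite S"
  by (simp add: states_def finite_V finite_residue_tuples)

lemma mem_S [simp]: "(c, F) \<in> S \<longleftrightarrow> c \<in> R \<and> F \<in> V"
  by (simp add: states_def)

lemma finite_trans_words: "F \<in> V \<Longrightarrow> finite (trans_words F F' n i c)"
  by (simp add: trans_words_def finite_node_words)

abbreviation "M i \<equiv> M_matrix g r a f \<Sigma> k p i"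

lemma M_eq: "F \<in> V \<Longrightarrow> M i (c, F) (c', F') = card (trans_words F F' p i (\<lambda>j. c' j - c j)) / k ^ p"
  by (simp add: M_matrix_def E_words_eq)

text \<open>Chapman-Kolmogorov: cut after \<open>n * p\<close> letters; the prefix determines the
  intermediate node and class. The suffix is weighted from position \<open>i + n * p\<close>, which
  periodicity replaces by \<open>i\<close>; hence the prefix length is a multiple of
  \<open>p\<close>, while \<open>m\<close> is free.\<close>

lemma card_trans_words_add:
  assumes "i \<ge> l" "F \<in> V" "c \<in> R" "c' \<in> R"
  shows "card (trans_words F F' (n * p + m) i (\<lambda>j. c' j - c j))
    = (\<Sum>(d, G)\<in>S. card (trans_words F G (n * p) i (\<lambda>j. d j - c j)) *
                    card (trans_words G F' m i (\<lambda>j. c' j - d j)))"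
proof -
  let ?A = "\<lambda>(d, G). trans_words F G (n * p) i (\<lambda>j. d j - c j)"
  let ?B = "\<lambda>(d, G). trans_words G F' m i (\<lambda>j. c' j - d j)"
  let ?T = "trans_words F F' (n * p + m) i (\<lambda>j. c' j - c j)"
  let ?U = "SIGMA s:S. ?A s \<times> ?B s"
  have node: "residual F u \<in> V" if "u \<in> F" for u using residual_node[OF assms(2) that] .
  have split: "congr (weight i (u @ v)) (\<lambda>j. c' j - c j) \<longleftrightarrow> congr (weight i v) (\<lambda>j. c' j - d j)"
    if "congr (weight i u) (\<lambda>j. d j - c j)" "length u = n * p" "u @ v \<in> F" for u v d
  proof -
    have "v \<in> L" using that(3) node_subset[OF assms(2)] L_appendD2 by blast
    then have per: "congr (weight (i + n * p) v) (weight i v)"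
      using weight_periodic[OF assms(1)] language_digits[OF subshift] by blast
    have "[weight i u j + weight (i + n * p) v j = c' j - c j] (mod int (a j))
        \<longleftrightarrow> [weight i v j = c' j - d j] (mod int (a j))" if "j \<in> {1..r}" for j
    proof -
      have "[weight i u j + weight (i + n * p) v j = (d j - c j) + weight i v j] (mod int (a j))"
        using that \<open>congr (weight i u) (\<lambda>j. d j - c j)\<close> per
        by (intro cong_add) (auto simp: cong_tuple_def)
      then have "[weight i u j + weight (i + n * p) v j = c' j - c j] (mod int (a j))
        \<longleftrightarrow> [(d j - c j) + weight i v j = c' j - c j] (mod int (a j))"
        by (meson cong_sym cong_trans)
      then show ?thesis by (simp add: cong_iff_dvd_diff algebra_simps)
    qed
    then show ?thesis by (simp add: cong_tuple_def weight_append that(2))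
  qed
  have "bij_betw (\<lambda>(s, u, v). u @ v) ?U ?T"
  proof (rule bij_betw_byWitness[where f' = "\<lambda>w. ((residue r a (\<lambda>j. c j + weight i (take (n * p) w) j),
      residual F (take (n * p) w)), take (n * p) w, drop (n * p) w)"])
    show "\<forall>x\<in>?U. ((residue r a (\<lambda>j. c j + weight i (take (n * p) (case x of (s, u, v) \<Rightarrow> u @ v)) j),
        residual F (take (n * p) (case x of (s, u, v) \<Rightarrow> u @ v))),
        take (n * p) (case x of (s, u, v) \<Rightarrow> u @ v), drop (n * p) (case x of (s, u, v) \<Rightarrow> u @ v)) = x"
      by (auto simp: trans_words_def node_words_def congr_diff_iff)
    show "\<forall>w\<in>?T. (case ((residue r a (\<lambda>j. c j + weight i (take (n * p) w) j),
        residual F (take (n * p) w)), take (n * p) w, drop (n * p) w) of (s, u, v) \<Rightarrow> u @ v) = w"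
      by simp
    show "(\<lambda>(s, u, v). u @ v) ` ?U \<subseteq> ?T"
      using split by (auto simp: trans_words_def node_words_def residual_append)
    show "(\<lambda>w. ((residue r a (\<lambda>j. c j + weight i (take (n * p) w) j),
        residual F (take (n * p) w)), take (n * p) w, drop (n * p) w)) ` ?T \<subseteq> ?U"
    proof (clarsimp simp: residue_in_R)
      fix w assume w: "w \<in> ?T"
      define u v where "u = take (n * p) w" and "v = drop (n * p) w"
      let ?d = "residue r a (\<lambda>j. c j + weight i u j)"
      have uv: "u @ v \<in> F" "w = u @ v" "length u = n * p" "length v = m" "u \<in> F"
        using w node_appendD1[OF assms(2), of u v]
        by (auto simp: u_def v_def trans_words_def node_words_def)
      have "congr (weight i u) (\<lambda>j. ?d j - c j)" by (simp add: congr_diff_iff residue_in_R)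
      moreover have "congr (weight i v) (\<lambda>j. c' j - ?d j)"
        using split[OF calculation uv(3,1)] w uv(2) by (simp add: trans_words_def)
      ultimately show "residual F u \<in> V \<and> u \<in> trans_words F (residual F u) (n * p) i (\<lambda>j. ?d j - c j)
          \<and> v \<in> trans_words (residual F u) F' m i (\<lambda>j. c' j - ?d j)"
        using w uv node[of u] by (simp add: trans_words_def node_words_def residual_append)
    qed
  qed
  then have "card ?T = card ?U" by (simp add: bij_betw_same_card)
  also have "\<dots> = (\<Sum>s\<in>S. card (?A s \<times> ?B s))"
    by (intro card_SigmaI finite_S) (auto simp: finite_trans_words assms(2))
  finally show ?thesis by (simp add: card_cartesian_product case_prod_beta)
qed

lemma matrix_power_M:
  assumes "i \<ge> l" "F \<in> V" "c \<in> R" "F' \<in> V" "c' \<in> R"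
  shows "matrix_power S (M i) n (c, F) (c', F')
    = card (trans_words F F' (n * p) i (\<lambda>j. c' j - c j)) / k ^ (n * p)"
  using assms(4,5)
proof (induction n arbitrary: F' c')
  case 0
  have "congr (weight i []) (\<lambda>j. c' j - c j) \<longleftrightarrow> c = c'"
    using congr_diff_iff[OF 0(2), of "weight i []" c] residue_id[OF assms(3)] by (simp add: weight_def)
  then have "trans_words F F' (0 * p) i (\<lambda>j. c' j - c j) = (if (c, F) = (c', F') then {[]} else {})"
    using Nil_in_node[OF assms(2)] by (auto simp: trans_words_def node_words_def)
  then show ?case by simp
next
  case (Suc n)
  have "matrix_power S (M i) (Suc n) (c, F) (c', F')
    = (\<Sum>(d, G)\<in>S. real (card (trans_words F G (n * p) i (\<lambda>j. d j - c j)) *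
                    card (trans_words G F' p i (\<lambda>j. c' j - d j))) / k ^ (n * p + p))"
    unfolding matrix_power.simps
    by (rule sum.cong) (auto simp: Suc.IH M_eq power_add)
  also have "\<dots> = card (trans_words F F' (n * p + p) i (\<lambda>j. c' j - c j)) / k ^ (n * p + p)"
    unfolding card_trans_words_add[OF assms(1-3) Suc.prems(2)]
    by (simp add: case_prod_beta sum_divide_distrib)
  finally show ?case by (simp add: add.commute)
qed

text \<open>Each of the \<open>k ^ p\<close> words readable from \<open>F\<close> leads to exactly
  one state.\<close>

lemma M_row_sum:
  assumes "s \<in> S"
  shows "(\<Sum>t\<in>S. M i s t) = 1"
proof -
  obtain c F where s: "s = (c, F)" "c \<in> R" "F \<in> V" using assms by (cases s) auto
  let ?key = "\<lambda>w. (residue r a (\<lambda>j. c j + weight i w j), residual F w)"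
  have "(\<Sum>t\<in>S. card {w \<in> node_words F p. ?key w = t}) = card (node_words F p)"
    by (rule sum_card_fibres[OF finite_node_words[OF s(3)] finite_S])
      (use residual_node[OF s(3)] in \<open>auto simp: residue_in_R node_words_def\<close>)
  moreover have eq: "card {w \<in> node_words F p. ?key w = t} = M i s t * k ^ p" if "t \<in> S" for t
    using that s k_ge_2
    by (cases t) (auto simp: M_eq trans_words_def congr_diff_iff conj_commute)
  moreover have "(\<Sum>t\<in>S. M i s t * k ^ p) = (\<Sum>t\<in>S. real (card {w \<in> node_words F p. ?key w = t}))"
    by (rule sum.cong) (simp_all only: eq)
  ultimately have "(\<Sum>t\<in>S. M i s t * k ^ p) = k ^ p"
    using card_node_words[OF s(3)] by (simp only: of_nat_sum[symmetric])
  then show ?thesis using k_ge_2 by (simp flip: sum_distrib_right)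
qed

text \<open>Dually, a final state and one of the \<open>k ^ p\<close> paths into its node determine
  the initial state; this is where the constant in-degree enters.\<close>

lemma M_column_sum:
  assumes "t \<in> S"
  shows "(\<Sum>s\<in>S. M i s t) = 1"
proof -
  obtain c' F' where t: "t = (c', F')" "c' \<in> R" "F' \<in> V" using assms by (cases t) auto
  let ?key = "\<lambda>(F, w). (residue r a (\<lambda>j. c' j - weight i w j), F)"
  have "(\<Sum>s\<in>S. card {x \<in> incoming F' p. ?key x = s}) = card (incoming F' p)"
    by (rule sum_card_fibres[OF finite_incoming finite_S]) (auto simp: residue_in_R incoming_def)
  moreover have eq: "card {x \<in> incoming F' p. ?key x = s} = M i s t * k ^ p" if "s \<in> S" for s
  proof -
    obtain c F where s: "s = (c, F)" "c \<in> R" "F \<in> V" using \<open>s \<in> S\<close> by (cases s) auto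
    have "residue r a (\<lambda>j. c' j - weight i w j) = c \<longleftrightarrow> congr (weight i w) (\<lambda>j. c' j - c j)" for w
    proof -
      have "residue r a (\<lambda>j. c' j - weight i w j) = c \<longleftrightarrow> congr (\<lambda>j. c' j - weight i w j) c"
        using residue_eq_iff residue_id[OF s(2)] by metis
      also have "\<dots> \<longleftrightarrow> congr (weight i w) (\<lambda>j. c' j - c j)"
        unfolding cong_tuple_def cong_iff_dvd_diff
        by (intro ball_cong refl) (subst dvd_minus_iff[symmetric], simp add: algebra_simps)
      finally show ?thesis .
    qed
    then have "{x \<in> incoming F' p. ?key x = s} = Pair F ` trans_words F F' p i (\<lambda>j. c' j - c j)"
      using s by (auto simp: incoming_def trans_words_def)
    then show ?thesis using s k_ge_2 by (simp add: t M_eq card_image inj_on_def)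
  qed
  moreover have "(\<Sum>s\<in>S. M i s t * k ^ p) = (\<Sum>s\<in>S. real (card {x \<in> incoming F' p. ?key x = s}))"
    by (rule sum.cong) (simp_all only: eq)
  ultimately have "(\<Sum>s\<in>S. M i s t * k ^ p) = k ^ p"
    using card_incoming[OF t(3)] by (simp only: of_nat_sum[symmetric])
  then show ?thesis using k_ge_2 by (simp flip: sum_distrib_right)
qed

lemma trans_words_limit:
  assumes "i \<ge> 1" "i \<ge> l" "F \<in> V" "F' \<in> V"
  shows "(\<lambda>n. card (trans_words F F' (n * p) i c) / k ^ (n * p)) \<longlonglongrightarrow> 1 / card S"
proof -
  \<comment> \<open>Only differences of classes enter the matrix, so the chain is started in the
    class of 0 and the class of \<open>c\<close> is its target.\<close>
  let ?z = "residue r a (\<lambda>_. 0)" and ?c = "residue r a c"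
  have "congr x c \<longleftrightarrow> congr x (\<lambda>j. ?c j - ?z j)" for x
  proof -
    have "residue r a (\<lambda>j. ?z j + x j) = residue r a x"
      unfolding residue_def by (auto simp: restrict_def fun_eq_iff mod_simps)
    then show ?thesis
      using cong_tuple_trans_left[of r a "\<lambda>j. ?z j + x j" x c]
      by (simp add: congr_diff_iff residue_in_R residue_eq_iff)
  qed
  then have "trans_words F F' n i c = trans_words F F' n i (\<lambda>j. ?c j - ?z j)" for n
    by (simp add: trans_words_def)
  moreover have "(\<lambda>n. matrix_power S (M i) n (?z, F) (?c, F')) \<longlonglongrightarrow> 1 / card S"
  proof (rule doubly_stochastic_power_limit)
    show "irreducible_matrix S (M i)" "aperiodic_matrix S (M i)"
      using markov assms(1,2) by (auto simp: markov_condition_def)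
    show "M i s t \<ge> 0" for s t by (cases s; cases t) (simp add: M_matrix_def)
  qed (use assms in \<open>auto simp: finite_S M_row_sum M_column_sum residue_in_R\<close>)
  ultimately show ?thesis using assms by (simp add: matrix_power_M residue_in_R)
qed

text \<open>Discrepancy: the signed deviation from the share that uniform distribution over the
  classes would give. Unlike a ratio of counts it is additive over disjoint sets.\<close>

definition disc :: "'x set \<Rightarrow> ('x \<Rightarrow> nat \<Rightarrow> int) \<Rightarrow> (nat \<Rightarrow> int) \<Rightarrow> real" where
  "disc W \<phi> c = card {w \<in> W. congr (\<phi> w) c} - card W / card R"

lemma abs_disc_le:
  assumes "finite W"
  shows "\<bar>disc W \<phi> c\<bar> \<le> card W"
proof -
  have "real (card {w \<in> W. congr (\<phi> w) c}) \<le> card W" using assms by (simp add: card_mono)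
  moreover have "card W / card R \<le> card W" "0 \<le> card W / card R"
    using card_R_pos by (auto simp: divide_simps mult_le_cancel_left1)
  ultimately show ?thesis unfolding disc_def by linarith
qed

text \<open>Sort the words by terminal node: \<open>v\<close> may follow iff that node contains
  \<open>v\<close>. So each class holds \<open>card ?V * \<mu>\<close> words up to
  \<open>card V * \<eta>\<close>. The mean over all classes obeys the same bound; comparing the two
  cancels \<open>\<mu>\<close> and costs the factor 2.\<close>

lemma disc_node:
  fixes \<mu> \<eta> :: real
  assumes "F \<in> V" and \<eta>: "\<And>F' c. F' \<in> V \<Longrightarrow> \<bar>card (trans_words F F' n i c) - \<mu>\<bar> \<le> \<eta>"
  shows "\<bar>disc {w \<in> node_words F n. w @ v \<in> F} (weight i) c\<bar> \<le> 2 * card V * \<eta>"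
proof -
  let ?W = "{w \<in> node_words F n. w @ v \<in> F}" and ?V = "{F' \<in> V. v \<in> F'}"
  let ?x = "\<lambda>c. real (card {w \<in> ?W. congr (weight i w) c})"
  have finW: "finite ?W" using finite_node_words[OF assms(1)] by simp
  have "0 \<le> \<eta>" using \<eta>[OF assms(1)] by (meson abs_ge_zero order_trans)
  have x: "\<bar>?x c - card ?V * \<mu>\<bar> \<le> card V * \<eta>" for c
  proof -
    let ?Y = "{w \<in> ?W. congr (weight i w) c}"
    have finY: "finite ?Y" using finW by (rule rev_finite_subset) auto
    have "(\<Sum>F'\<in>?V. card {w \<in> ?Y. residual F w = F'}) = card ?Y"
      by (rule sum_card_fibres[OF finY]) (use finite_V residual_node[OF assms(1)] in \<open>auto simp: node_words_def\<close>)
    moreover have "{w \<in> ?Y. residual F w = F'} = trans_words F F' n i c" if "F' \<in> ?V" for F'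
      using that by (auto simp: trans_words_def)
    ultimately have "?x c = (\<Sum>F'\<in>?V. real (card (trans_words F F' n i c)))" by (simp flip: of_nat_sum)
    then have "\<bar>?x c - card ?V * \<mu>\<bar> = \<bar>\<Sum>F'\<in>?V. card (trans_words F F' n i c) - \<mu>\<bar>"
      by (simp add: sum_subtractf)
    also have "\<dots> \<le> (\<Sum>F'\<in>?V. \<eta>)" by (rule order_trans[OF sum_abs sum_mono]) (simp add: \<eta>)
    also have "\<dots> \<le> card V * \<eta>" using \<open>0 \<le> \<eta>\<close> finite_V by (simp add: mult_right_mono card_mono)
    finally show ?thesis .
  qed
  have "(\<Sum>c\<in>R. card {w \<in> ?W. residue r a (weight i w) = c}) = card ?W"
    by (rule sum_card_fibres[OF finW finite_residue_tuples]) (auto simp: residue_in_R)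
  moreover have "residue r a y = c \<longleftrightarrow> congr y c" if "c \<in> R" for c y
    using residue_eq_iff residue_id[OF that] by metis
  ultimately have "(\<Sum>c\<in>R. card {w \<in> ?W. congr (weight i w) c}) = card ?W" by simp
  then have "card ?W - card R * (card ?V * \<mu>) = (\<Sum>c\<in>R. ?x c - card ?V * \<mu>)"
    by (simp add: sum_subtractf flip: of_nat_sum)
  also have "\<bar>\<dots>\<bar> \<le> (\<Sum>c\<in>R. card V * \<eta>)"
    by (rule order_trans[OF sum_abs sum_mono]) (rule x)
  finally have "\<bar>card ?W / card R - card ?V * \<mu>\<bar> \<le> card V * \<eta>"
    using card_R_pos by (simp add: abs_le_iff field_simps)
  with x[of c] show ?thesis unfolding disc_def by linarith
qed

text \<open>A fixed prefix \<open>u\<close> merely shifts the class demanded of the middle part by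
  the weight of \<open>u\<close>.\<close>

lemma disc_L_words_split:
  "disc (L_words v (i + m)) (weight 0) c =
   (\<Sum>u\<in>L_words [] i. disc {x. length x = m \<and> u @ x @ v \<in> L} (weight i) (\<lambda>j. c j - weight 0 u j))"
proof -
  let ?X = "\<lambda>u. {x. length x = m \<and> u @ x @ v \<in> L}"
  have fin: "finite (?X u)" for u
    by (rule finite_subset[OF _ finite_L_words[of v m]]) (auto simp: L_words_def dest: L_appendD2)
  have card: "card {w \<in> L_words v (i + m). P w} = (\<Sum>u\<in>L_words [] i. card {x \<in> ?X u. P (u @ x)})" for P
  proof -
    let ?U = "SIGMA u:L_words [] i. {x \<in> ?X u. P (u @ x)}"
    have "bij_betw (\<lambda>(u, x). u @ x) ?U {w \<in> L_words v (i + m). P w}"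
    proof (rule bij_betw_byWitness[where f' = "\<lambda>w. (take i w, drop i w)"])
      have "take i w \<in> L \<and> take i w @ drop i w @ v \<in> L" if "w @ v \<in> L" for w
      proof -
        have "(take i w @ drop i w) @ v \<in> L" using that by simp
        then have "take i w @ drop i w @ v \<in> L" unfolding append_assoc .
        then show ?thesis using L_appendD1 by blast
      qed
      then show "(\<lambda>w. (take i w, drop i w)) ` {w \<in> L_words v (i + m). P w} \<subseteq> ?U"
        by (auto simp: L_words_def)
    qed (auto simp: L_words_def)
    then have "card {w \<in> L_words v (i + m). P w} = card ?U" by (simp add: bij_betw_same_card)
    also have "\<dots> = (\<Sum>u\<in>L_words [] i. card {x \<in> ?X u. P (u @ x)})"
      by (intro card_SigmaI finite_L_words ballI finite_subset[OF _ fin]) auto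
    finally show ?thesis .
  qed
  have shift: "congr (weight 0 (u @ x)) c \<longleftrightarrow> congr (weight i x) (\<lambda>j. c j - weight 0 u j)"
    if "u \<in> L_words [] i" for u x
    using that cong_tuple_add_left[of r a "weight 0 u" "weight i x" c]
    by (simp add: weight_append[abs_def] L_words_def)
  have 1: "real (card {w \<in> L_words v (i + m). congr (weight 0 w) c}) =
      (\<Sum>u\<in>L_words [] i. real (card {x \<in> ?X u. congr (weight i x) (\<lambda>j. c j - weight 0 u j)}))"
    unfolding card of_nat_sum by (rule sum.cong) (simp_all only: shift)
  have 2: "card (L_words v (i + m)) / card R = (\<Sum>u\<in>L_words [] i. card (?X u) / card R)"
    using card[of "\<lambda>_. True"] by (simp add: sum_divide_distrib)
  show ?thesis by (simp only: disc_def sum_subtractf 1 2)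
qed

text \<open>A word is cut into a prefix of length \<open>i\<close>, which is synchronizing up to a small proportion of
  exceptions, and a rest whose length is a multiple of \<open>p\<close>, which is governed by \<open>M\<^sub>i\<close>.\<close>

lemma disc_L_words_small:
  fixes e :: real
  assumes "e > 0"
  shows "eventually (\<lambda>n. \<forall>v c. \<bar>disc (L_words v n) (weight 0) c\<bar> \<le> e * k ^ n) sequentially"
proof -
  \<comment> \<open>There are at most \<open>card V * k ^ i\<close> prefixes, and a synchronizing
    one costs \<open>2 * card V * \<eta>\<close>; \<open>e2\<close> turns this into half of
    \<open>e * k ^ N\<close>. At most \<open>e1 * k ^ i\<close> prefixes are not synchronizing, each
    costing at most \<open>card V * k ^ (n * p)\<close>; that is the other half.\<close>
  define e1 e2 where "e1 = e / (2 * card V)" and "e2 = e / (4 * card V ^ 2)"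
  have e12: "e1 > 0" "e2 > 0" using assms card_V_pos by (auto simp: e1_def e2_def)
  let ?N = "\<lambda>i. {u \<in> L. length u = i \<and> \<not> synchronizing \<Sigma> u}"
  have "eventually (\<lambda>i. card (?N i) / k ^ i < e1) sequentially"
    using order_tendstoD(2)[OF nonsync_density e12(1)] .
  then have "eventually (\<lambda>i. i \<ge> max 1 l \<and> card (?N i) / k ^ i < e1) sequentially"
    using eventually_conj[OF eventually_ge_at_top] by blast
  then obtain i0 where i0: "\<And>i. i \<ge> i0 \<Longrightarrow> i \<ge> 1 \<and> i \<ge> l \<and> card (?N i) / k ^ i < e1"
    unfolding eventually_sequentially by auto
  \<comment> \<open>One cut position for each residue of the total length modulo \<open>p\<close>.
    Positions, nodes and representatives of classes are finite in number, so a single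
    \<open>n0\<close> serves them all.\<close>
  have "eventually (\<lambda>n. \<forall>i\<in>{i0..<i0+p}. \<forall>F\<in>V. \<forall>F'\<in>V. \<forall>c\<in>R.
      \<bar>card (trans_words F F' (n * p) i c) / k ^ (n * p) - 1 / card S\<bar> < e2) sequentially"
    using i0 tendstoD[OF trans_words_limit e12(2)]
    by (intro eventually_ball_finite ballI finite_V finite_residue_tuples finite_atLeastLessThan)
      (auto simp: dist_real_def)
  then obtain n0 where n0: "\<And>n i F F' c. n \<ge> n0 \<Longrightarrow> i \<in> {i0..<i0+p} \<Longrightarrow> F \<in> V \<Longrightarrow> F' \<in> V \<Longrightarrow> c \<in> R \<Longrightarrow>
      \<bar>card (trans_words F F' (n * p) i c) / k ^ (n * p) - 1 / card S\<bar> < e2"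
    unfolding eventually_sequentially by blast
  have "\<bar>disc (L_words v N) (weight 0) c\<bar> \<le> e * k ^ N" if N: "N \<ge> i0 + n0 * p" for N v c
  proof -
    define n i where "n = (N - i0) div p" and "i = i0 + (N - i0) mod p"
    have i: "i \<in> {i0..<i0+p}" using p_pos by (auto simp: i_def)
    have ii0: "i \<ge> i0" using i by simp
    have "n0 * p \<le> N - i0" using N by simp
    then have n: "n \<ge> n0" unfolding n_def using p_pos by (simp add: less_eq_div_iff_mult_less_eq)
    have "N - i0 = n * p + (N - i0) mod p" by (simp add: n_def)
    then have N_eq: "N = i + n * p" using N by (simp add: i_def)
    define \<mu> \<eta> where "\<mu> = real k ^ (n * p) / card S" and "\<eta> = e2 * real k ^ (n * p)"
    have kpos: "real k ^ m > 0" for m using k_ge_2 by simp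
    have trans: "\<bar>card (trans_words F F' (n * p) i c) - \<mu>\<bar> \<le> \<eta>" if "F \<in> V" "F' \<in> V" for F F' c
    proof -
      have "trans_words F F' (n * p) i c = trans_words F F' (n * p) i (residue r a c)"
        by (simp add: trans_words_def residue_id[OF residue_in_R] flip: residue_eq_iff)
      moreover have "\<bar>(x / y - 1 / s)\<bar> < z \<Longrightarrow> \<bar>x - y / s\<bar> \<le> z * y" if "y > 0" for x y s z :: real
      proof -
        assume "\<bar>x / y - 1 / s\<bar> < z"
        then have "\<bar>x / y - 1 / s\<bar> * y \<le> z * y" using that by simp
        moreover have "\<bar>x / y - 1 / s\<bar> * y = \<bar>(x / y - 1 / s) * y\<bar>" using that by (simp add: abs_mult)
        moreover have "(x / y - 1 / s) * y = x - y / s" using that by (simp add: left_diff_distrib)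
        ultimately show ?thesis by simp
      qed
      ultimately show ?thesis
        using n0[OF n i that residue_in_R[of c]] kpos[of "n * p"] by (simp add: \<mu>_def \<eta>_def)
    qed
    let ?X = "\<lambda>u. {x. length x = n * p \<and> u @ x @ v \<in> L}"
    let ?d = "\<lambda>u. disc (?X u) (weight i) (\<lambda>j. c j - weight 0 u j)"
    have sync: "\<bar>?d u\<bar> \<le> 2 * card V * \<eta>" if "synchronizing \<Sigma> u" for u
    proof -
      have F: "residual L u \<in> V" using that by (auto simp: V_eq)
      have "?X u = {x \<in> node_words (residual L u) (n * p). x @ v \<in> residual L u}"
        by (auto simp: node_words_def dest: L_appendD1[of "u @ x" v for x, simplified])
      then show ?thesis using disc_node[OF F trans[OF F]] by simp
    qed
    \<comment> \<open>The trivial bound, for the rare prefixes that are not synchronizing.\<close>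
    have all: "\<bar>?d u\<bar> \<le> card V * real k ^ (n * p)" for u
    proof -
      have sub: "?X u \<subseteq> L_words v (n * p)" by (auto simp: L_words_def dest: L_appendD2)
      have "\<bar>?d u\<bar> \<le> card (?X u)" by (rule abs_disc_le[OF finite_subset[OF sub finite_L_words]])
      also have "\<dots> \<le> card (L_words v (n * p))" using card_mono[OF finite_L_words sub] by simp
      also have "\<dots> \<le> real (card V * k ^ (n * p))" using card_L_words_le by (simp only: of_nat_le_iff)
      finally show ?thesis by simp
    qed
    have "\<bar>disc (L_words v N) (weight 0) c\<bar> \<le> (\<Sum>u\<in>L_words [] i. \<bar>?d u\<bar>)"
      unfolding N_eq disc_L_words_split by (rule sum_abs)
    also have "\<dots> \<le> (\<Sum>u\<in>L_words [] i. 2 * card V * \<eta> +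
        (if \<not> synchronizing \<Sigma> u then card V * real k ^ (n * p) else 0))"
      using sync all e12 kpos[of "n * p"]
      by (intro sum_mono) (auto simp: \<eta>_def intro: add_increasing)
    also have "\<dots> = card (L_words [] i) * (2 * card V * \<eta>) + card (?N i) * (card V * real k ^ (n * p))"
    proof -
      have "{u \<in> L_words [] i. \<not> synchronizing \<Sigma> u} = ?N i" by (auto simp: L_words_def)
      then show ?thesis by (simp add: sum.distrib sum.inter_filter[symmetric] finite_L_words)
    qed
    also have "\<dots> \<le> (card V * real k ^ i) * (2 * card V * \<eta>) + (e1 * real k ^ i) * (card V * real k ^ (n * p))"
    proof (intro add_mono mult_right_mono)
      show "real (card (L_words [] i)) \<le> card V * real k ^ i"
        using card_L_words_le[of "[]" i] by (simp flip: of_nat_power of_nat_mult)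
      show "real (card (?N i)) \<le> e1 * real k ^ i"
        using i0[OF ii0] kpos[of i] by (simp add: field_simps)
    qed (use e12 kpos[of "n * p"] in \<open>auto simp: \<eta>_def\<close>)
    also have "\<dots> = real k ^ N * (2 * (real (card V))\<^sup>2 * e2 + e1 * card V)"
      by (simp add: \<eta>_def N_eq power_add algebra_simps power2_eq_square)
    also have "2 * (real (card V))\<^sup>2 * e2 + e1 * card V = e"
      using card_V_pos by (simp add: e1_def e2_def field_simps)
    finally show ?thesis by (simp add: mult.commute)
  qed
  then show ?thesis unfolding eventually_sequentially by blast
qed

end

section \<open>Equidistribution on integers\<close>

lemma word_val_snoc: "word_val g (w @ [d]) = word_val g w + d * g ^ length w"
  unfolding word_val_def by (simp add: nth_append)

lemma word_val_append: "word_val g (u @ v) = word_val g u + g ^ length u * word_val g v"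
proof (induction v rule: rev_induct)
  case Nil
  show ?case by (simp add: word_val_def)
next
  case (snoc d v)
  have "word_val g (u @ v @ [d]) = word_val g (u @ v) + d * g ^ length (u @ v)"
    using word_val_snoc[of g "u @ v" d] by simp
  with snoc show ?case by (simp add: word_val_snoc power_add algebra_simps)
qed

lemma word_val_less: "(\<And>d. d \<in> set w \<Longrightarrow> d < g) \<Longrightarrow> word_val g w < g ^ length w"
proof (induction w rule: rev_induct)
  case Nil
  show ?case by (simp add: word_val_def)
next
  case (snoc d w)
  have "word_val g (w @ [d]) < g ^ length w + d * g ^ length w"
    using snoc by (simp add: word_val_snoc)
  also have "\<dots> = Suc d * g ^ length w" by simp
  also have "\<dots> \<le> g * g ^ length w" using snoc.prems by (intro mult_right_mono) (auto simp: Suc_le_eq)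
  finally show ?case by simp
qed

lemma word_val_inj:
  assumes "length u = length v" "\<And>d. d \<in> set u \<union> set v \<Longrightarrow> d < g" "word_val g u = word_val g v"
  shows "u = v"
  using assms
proof (induction u v rule: list_induct2)
  case (Cons x u y v)
  have *: "word_val g (z # w) = z + g * word_val g w" for z w
    using word_val_append[of g "[z]" w] by (simp add: word_val_def)
  have "x < g" "y < g" using Cons.prems(1) by auto
  have eq: "x + g * word_val g u = y + g * word_val g v" using Cons.prems(2) * by simp
  then have "(x + g * word_val g u) mod g = (y + g * word_val g v) mod g" by simp
  then have "x = y" using \<open>x < g\<close> \<open>y < g\<close> by simp
  then have "word_val g u = word_val g v" using eq \<open>x < g\<close> by simp
  then show ?case using Cons.IH Cons.prems(1) \<open>x = y\<close> by auto
qed simp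

text \<open>For \<open>k \<ge> 2\<close> the powers \<open>k ^ t\<close> with \<open>t < m\<close>
  add up to at most \<open>k ^ m\<close>, so the terms from \<open>J\<close> on stay small relative
  to \<open>k ^ m\<close>; the earlier ones form a constant \<open>C\<close>.\<close>

lemma sum_lessThan_small:
  fixes x :: "nat \<Rightarrow> real" and k :: real
  assumes "k \<ge> 2" "(\<lambda>n. x n / k ^ n) \<longlonglongrightarrow> 0"
  shows "(\<lambda>m. (\<Sum>t<m. x t) / k ^ m) \<longlonglongrightarrow> 0"
proof (rule LIMSEQ_I)
  fix e :: real assume "e > 0"
  obtain J where J: "\<And>n. n \<ge> J \<Longrightarrow> norm (x n / k ^ n - 0) < e / 2"
    using LIMSEQ_D[OF assms(2), of "e / 2"] \<open>e > 0\<close> by auto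
  have kpos: "k ^ n > 0" for n using assms(1) by simp
  have x: "\<bar>x n\<bar> \<le> e / 2 * k ^ n" if "n \<ge> J" for n
    using J[OF that] kpos[of n] by (simp add: abs_divide field_simps abs_of_pos[OF kpos])
  define C where "C = \<bar>\<Sum>t<J. x t\<bar>"
  have S: "\<bar>\<Sum>t<m. x t\<bar> \<le> C + e / 2 * k ^ m" if "m \<ge> J" for m
    using that
  proof (induction m rule: nat_induct_at_least)
    case base
    show ?case using \<open>e > 0\<close> kpos[of J] by (simp add: C_def)
  next
    case (Suc m)
    have "\<bar>\<Sum>t<Suc m. x t\<bar> \<le> C + e / 2 * (2 * k ^ m)" using Suc x[OF Suc.hyps] by simp
    also have "2 * k ^ m \<le> k ^ Suc m" using assms(1) kpos[of m] by simp
    finally show ?case using \<open>e > 0\<close> by simp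
  qed
  have "(\<lambda>m. C * (1 / k) ^ m) \<longlonglongrightarrow> 0"
    using assms(1) by (intro tendsto_mult_right_zero LIMSEQ_realpow_zero) auto
  then obtain J' where J': "\<And>m. m \<ge> J' \<Longrightarrow> norm (C * (1 / k) ^ m - 0) < e / 2"
    using LIMSEQ_D[of _ 0 "e / 2"] \<open>e > 0\<close> by (metis half_gt_zero)
  have "norm ((\<Sum>t<m. x t) / k ^ m - 0) < e" if "m \<ge> max J J'" for m
  proof -
    have "\<bar>\<Sum>t<m. x t\<bar> / k ^ m \<le> (C + e / 2 * k ^ m) / k ^ m"
      using S[of m] that kpos[of m] by (intro divide_right_mono) auto
    also have "\<dots> = C * (1 / k) ^ m + e / 2" using assms(1) by (simp add: add_divide_distrib power_divide)
    also have "\<dots> < e" using J'[of m] that by (simp add: abs_less_iff)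
    finally show ?thesis using kpos[of m] by (simp add: abs_divide)
  qed
  then show "\<exists>no. \<forall>m\<ge>no. norm ((\<Sum>t<m. x t) / k ^ m - 0) < e" by blast
qed

text \<open>A function of intervals which is small on the intervals \<open>[q g\<^sup>j, (q + 1) g\<^sup>j)\<close>, \<open>q \<ge> 1\<close>, is
  small on initial segments: every interval \<open>[0, N)\<close> consists of the point 0 and at most about
  \<open>2 g j\<close> intervals of this form for each exponent.\<close>

lemma interval_bound:
  fixes D :: "nat \<Rightarrow> nat \<Rightarrow> real" and \<epsilon> :: "nat \<Rightarrow> real" and k :: real
  assumes "g \<ge> 2" "k \<ge> 2"
    and add: "\<And>x y z. x \<le> y \<Longrightarrow> y \<le> z \<Longrightarrow> D x z = D x y + D y z"
    and block: "\<And>q j. q \<ge> 1 \<Longrightarrow> \<bar>D (q * g ^ j) (Suc q * g ^ j)\<bar> \<le> \<epsilon> j"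
    and \<epsilon>: "(\<lambda>n. \<epsilon> n / k ^ n) \<longlonglongrightarrow> 0"
  obtains P where "(\<lambda>m. P m / k ^ m) \<longlonglongrightarrow> 0" "\<And>m N. N \<le> g ^ m \<Longrightarrow> \<bar>D 0 N\<bar> \<le> P m"
proof -
  \<comment> \<open>\<open>Q m\<close> bounds \<open>D\<close> on an interval of length at most
    \<open>g ^ m\<close> that starts at a positive multiple of \<open>g ^ m\<close>: at most
    \<open>g\<close> blocks for each exponent below \<open>m\<close>, then possibly one unit block,
    whence \<open>\<epsilon> 0\<close>. \<open>P m\<close> bounds \<open>D\<close> on initial
    segments: the point 0, then for each exponent \<open>t\<close> at most \<open>g\<close> blocks
    and a remainder of the kind bounded by \<open>Q t\<close>.\<close>
  define Q where "Q m = \<epsilon> 0 + (\<Sum>t<m. g * \<epsilon> t)" for m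
  define P where "P m = \<bar>D 0 1\<bar> + (\<Sum>t<m. g * \<epsilon> t + Q t)" for m
  have [simp]: "D x x = 0" for x using add[of x x x] by simp
  have \<epsilon>0: "\<epsilon> j \<ge> 0" for j using block[of 1 j] by (meson abs_ge_zero le_numeral_extra(4) order_trans)
  have Q0: "Q m \<ge> 0" for m using \<epsilon>0 by (auto simp: Q_def intro!: add_nonneg_nonneg sum_nonneg)
  have gpos: "g ^ m > 0" for m using assms(1) by simp
  have blocks: "\<bar>D (q * g ^ m) ((q + y) * g ^ m)\<bar> \<le> y * \<epsilon> m" if "q \<ge> 1" for q y m
  proof (induction y)
    case (Suc y)
    have "D (q * g ^ m) ((q + Suc y) * g ^ m)
        = D (q * g ^ m) ((q + y) * g ^ m) + D ((q + y) * g ^ m) (Suc (q + y) * g ^ m)"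
      by (subst add[of _ "(q + y) * g ^ m"]) (auto simp: algebra_simps)
    then show ?case using Suc block[of "q + y" m] that by (simp add: algebra_simps)
  qed simp
  have tail: "\<bar>D (q * g ^ m) (q * g ^ m + x)\<bar> \<le> Q m" if "q \<ge> 1" "x \<le> g ^ m" for q x m
    using that
  proof (induction m arbitrary: q x)
    case 0
    then have "x = 0 \<or> x = 1" by auto
    then show ?case using block[of q 0] \<epsilon>0[of 0] 0 by (auto simp: Q_def)
  next
    case (Suc m)
    define y where "y = x div g ^ m"
    have x: "x = y * g ^ m + x mod g ^ m" unfolding y_def by (rule div_mult_mod_eq[symmetric])
    have "y \<le> g * g ^ m div g ^ m" unfolding y_def using Suc.prems(2) by (intro div_le_mono) simp
    then have y: "y \<le> g" using assms(1) by simp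
    have e1: "q * g ^ Suc m = (q * g) * g ^ m" by simp
    have e2: "(q * g) * g ^ m + x = (q * g + y) * g ^ m + x mod g ^ m"
      by (subst (1) x) (simp add: add_mult_distrib)
    have qg: "q * g \<ge> 1" using Suc.prems(1) assms(1) by simp
    have "D (q * g ^ Suc m) (q * g ^ Suc m + x)
        = D ((q * g) * g ^ m) ((q * g + y) * g ^ m)
        + D ((q * g + y) * g ^ m) ((q * g + y) * g ^ m + x mod g ^ m)"
      unfolding e1 e2 by (rule add) (simp_all add: add_mult_distrib)
    also have "\<bar>\<dots>\<bar> \<le> y * \<epsilon> m + Q m"
      using blocks[OF qg, of m y] Suc.IH[of "q * g + y" "x mod g ^ m"] qg gpos[of m] by simp
    also have "\<dots> \<le> g * \<epsilon> m + Q m" using y \<epsilon>0[of m] by (simp add: mult_right_mono)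
    finally show ?case by (simp add: Q_def)
  qed
  have head: "\<bar>D 0 N\<bar> \<le> P m" if "N \<le> g ^ m" for N m
    using that
  proof (induction m arbitrary: N)
    case 0
    then have "N = 0 \<or> N = 1" by auto
    then show ?case by (auto simp: P_def)
  next
    case (Suc m)
    have step: "P (Suc m) = P m + (g * \<epsilon> m + Q m)" by (simp add: P_def)
    show ?case
    proof (cases "N \<le> g ^ m")
      case True
      have "g * \<epsilon> m + Q m \<ge> 0" using \<epsilon>0 Q0 by simp
      with Suc.IH[OF True] step show ?thesis by linarith
    next
      case False
      define y where "y = N div g ^ m"
      have N: "N = y * g ^ m + N mod g ^ m" unfolding y_def by (rule div_mult_mod_eq[symmetric])
      have "y \<le> g * g ^ m div g ^ m" unfolding y_def using Suc.prems by (intro div_le_mono) simp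
      then have y: "y \<le> g" using assms(1) by simp
      have "1 \<le> y" unfolding y_def using False gpos[of m] by (simp add: div_greater_zero_iff Suc_le_eq)
      then obtain z where z: "y = 1 + z" using le_Suc_ex by blast
      \<comment> \<open>Cut at \<open>g ^ m\<close> and at \<open>y * g ^ m\<close>: beyond
        \<open>g ^ m\<close> every block has a positive index, so \<open>blocks\<close> and
        \<open>tail\<close> apply.\<close>
      have "D 0 N = D 0 (g ^ m) + D (g ^ m) N" using False by (intro add) auto
      also have "D (g ^ m) N = D (g ^ m) (y * g ^ m) + D (y * g ^ m) N"
        using \<open>1 \<le> y\<close> by (intro add) (auto simp: y_def)
      finally have "D 0 N = D 0 (g ^ m) + D (1 * g ^ m) ((1 + z) * g ^ m)
          + D (y * g ^ m) (y * g ^ m + N mod g ^ m)" using N z by simp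
      moreover have "\<bar>D 0 (g ^ m)\<bar> \<le> P m" by (rule Suc.IH) simp
      moreover have "\<bar>D (1 * g ^ m) ((1 + z) * g ^ m)\<bar> \<le> z * \<epsilon> m" by (rule blocks) simp
      moreover have "z * \<epsilon> m \<le> g * \<epsilon> m" using y z \<epsilon>0[of m] by (intro mult_right_mono) auto
      moreover have "\<bar>D (y * g ^ m) (y * g ^ m + N mod g ^ m)\<bar> \<le> Q m"
        using \<open>1 \<le> y\<close> gpos[of m] by (intro tail) auto
      ultimately show ?thesis unfolding step by linarith
    qed
  qed
  have const: "(\<lambda>m. C / k ^ m) \<longlonglongrightarrow> 0" for C :: real
  proof -
    have "(\<lambda>m. C * (1 / k) ^ m) \<longlonglongrightarrow> 0"
      using assms(2) by (intro tendsto_mult_right_zero LIMSEQ_realpow_zero) auto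
    then show ?thesis by (simp add: power_divide)
  qed
  have g\<epsilon>: "(\<lambda>t. g * \<epsilon> t / k ^ t) \<longlonglongrightarrow> 0"
    using tendsto_mult_right_zero[OF \<epsilon>, of "real g"] by simp
  have "(\<lambda>m. \<epsilon> 0 / k ^ m + (\<Sum>t<m. g * \<epsilon> t) / k ^ m) \<longlonglongrightarrow> 0"
    using tendsto_add[OF const sum_lessThan_small[OF assms(2) g\<epsilon>]] by simp
  then have "(\<lambda>m. Q m / k ^ m) \<longlonglongrightarrow> 0" by (simp add: Q_def add_divide_distrib)
  with g\<epsilon> have "(\<lambda>t. (g * \<epsilon> t + Q t) / k ^ t) \<longlonglongrightarrow> 0"
    using tendsto_add[of _ 0 _ _ 0] by (simp add: add_divide_distrib)
  from tendsto_add[OF const sum_lessThan_small[OF assms(2) this]]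
  have "(\<lambda>m. P m / k ^ m) \<longlonglongrightarrow> 0" by (simp add: P_def add_divide_distrib)
  with head show ?thesis using that by blast
qed

section \<open>Transfer from words to integers\<close>

context weighted_shift
begin

abbreviation "A \<equiv> A_set g \<Sigma>"

lemma L_word_val_less: "w \<in> L \<Longrightarrow> word_val g w < g ^ length w"
  using language_digits[OF subshift] by (intro word_val_less) auto

lemma L_word_val_inj:
  "u \<in> L \<Longrightarrow> v \<in> L \<Longrightarrow> length u = length v \<Longrightarrow> word_val g u = word_val g v \<Longrightarrow> u = v"
  using language_digits[OF subshift] by (intro word_val_inj) auto

lemma congr_word_val: "w \<in> L \<Longrightarrow> congr (\<lambda>j. f j (word_val g w)) c \<longleftrightarrow> congr (weight 0 w) c"
  using f_word_val[of _ w 0] language_digits[OF subshift, of w] by (simp add: cong_tuple_def)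

text \<open>The value of \<open>v\<close> is below \<open>g ^ length v\<close>, so the digits of
  \<open>y\<close> beyond that length vanish and the remaining ones are those of
  \<open>v\<close>.\<close>

lemma L_shortest_word:
  assumes "v \<in> L" "y \<in> L" "word_val g v = word_val g y" "length v \<le> length y"
  shows "\<exists>z. y = v @ z"
proof -
  define y1 y2 where "y1 = take (length v) y" and "y2 = drop (length v) y"
  have y: "y = y1 @ y2" "length y1 = length v" using assms(4) by (auto simp: y1_def y2_def)
  then have "y1 \<in> L" using assms(2) L_appendD1 by blast
  have val: "word_val g v = word_val g y1 + g ^ length v * word_val g y2"
    using assms(3) y by (simp add: word_val_append)
  have "word_val g y2 = 0"
  proof (rule ccontr)
    assume "word_val g y2 \<noteq> 0"
    then have "g ^ length v * 1 \<le> g ^ length v * word_val g y2" by (intro mult_left_mono) auto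
    with val L_word_val_less[OF assms(1)] show False by simp
  qed
  then have "v = y1" using val L_word_val_inj[OF assms(1) \<open>y1 \<in> L\<close>] y(2) by simp
  with y show ?thesis by blast
qed

text \<open>If no word has value \<open>q\<close>, the interval contains no element of
  \<open>A\<close>. Otherwise \<open>v\<close> is a shortest word of value \<open>q\<close>; these
  fixed high digits shift the class demanded of the low ones by \<open>weight n v\<close>.\<close>

lemma disc_block:
  assumes "q \<ge> 1"
  shows "A \<inter> {q * g ^ n..<Suc q * g ^ n} = {} \<or>
    (\<exists>v c'. disc (A \<inter> {q * g ^ n..<Suc q * g ^ n}) (\<lambda>m j. f j m) c = disc (L_words v n) (weight 0) c')"
proof -
  let ?B = "A \<inter> {q * g ^ n..<Suc q * g ^ n}"
  let ?Q = "{y \<in> L. word_val g y = q}"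
  have gn: "g ^ n > 0" using g_pos by simp
  have div: "q * g ^ n \<le> x \<and> x < Suc q * g ^ n \<longleftrightarrow> x div g ^ n = q" for x
    using gn by (metis div_nat_eqI dividend_less_times_div div_times_less_eq_dividend mult.commute mult_Suc_right add.commute)
  have split: "length w \<ge> n \<and> word_val g (drop n w) = q" if "w \<in> L" "word_val g w \<in> ?B" for w
  proof -
    have d: "word_val g w div g ^ n = q" using that(2) div by auto
    have "n \<le> length w"
    proof (rule ccontr)
      assume "\<not> n \<le> length w"
      then have "g ^ length w \<le> g ^ n" using g_pos by (intro power_increasing) auto
      \<comment> \<open>Here \<open>q \<ge> 1\<close> rules out words with fewer than
        \<open>n\<close> letters.\<close>
      then have "word_val g w div g ^ n = 0" using L_word_val_less[OF that(1)] by simp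
      with d assms show False by simp
    qed
    moreover have "word_val g w = word_val g (take n w) + g ^ n * word_val g (drop n w)"
      using word_val_append[of g "take n w" "drop n w"] calculation by simp
    moreover have "word_val g (take n w) < g ^ n"
      using L_word_val_less[of "take n w"] L_appendD1[of "take n w" "drop n w"] that(1) calculation(1) by simp
    ultimately show ?thesis using d gn by simp
  qed
  show ?thesis
  proof (cases "?Q = {}")
    case True
    have "?B = {}"
    proof (rule ccontr)
      assume "?B \<noteq> {}"
      then obtain w where w: "w \<in> L" "word_val g w \<in> ?B" unfolding A_set_def by blast
      then have "drop n w \<in> ?Q" using split L_appendD2[of "take n w" "drop n w"] by simp
      with True show False by blast
    qed
    then show ?thesis by blast
  next
    case False
    then obtain v where v: "v \<in> ?Q" "\<And>y. y \<in> ?Q \<Longrightarrow> length v \<le> length y"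
      using ex_has_least_nat[of "\<lambda>y. y \<in> ?Q" _ length] by blast
    let ?h = "\<lambda>u. word_val g (u @ v)"
    have inj: "inj_on ?h (L_words v n)"
    proof (rule inj_onI)
      fix u u' assume "u \<in> L_words v n" "u' \<in> L_words v n" "?h u = ?h u'"
      then have "u @ v = u' @ v" by (intro L_word_val_inj) (auto simp: L_words_def)
      then show "u = u'" by simp
    qed
    have h: "?h u = word_val g u + g ^ n * q" if "u \<in> L_words v n" for u
      using that v(1) by (simp add: word_val_append L_words_def)
    have image: "?h ` L_words v n = ?B"
    proof (intro equalityI subsetI)
      fix x assume "x \<in> ?h ` L_words v n"
      then obtain u where u: "u \<in> L_words v n" "x = ?h u" by blast
      then have "word_val g u < g ^ n"
        using L_word_val_less[of u] L_appendD1[of u v] by (simp add: L_words_def)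
      then have "x div g ^ n = q" using u h gn by simp
      then show "x \<in> ?B" using div u by (auto simp: A_set_def L_words_def)
    next
      fix x assume x: "x \<in> ?B"
      then obtain w where w: "w \<in> L" "x = word_val g w" by (auto simp: A_set_def)
      have sp: "length w \<ge> n" "word_val g (drop n w) = q" using split[OF w(1)] x w(2) by auto
      have "drop n w \<in> L" using w(1) L_appendD2[of "take n w" "drop n w"] by simp
      moreover from this have "length v \<le> length (drop n w)" using v(2) sp(2) by blast
      moreover have "v \<in> L" "word_val g v = word_val g (drop n w)" using v(1) sp(2) by auto
      ultimately obtain z where z: "drop n w = v @ z" using L_shortest_word by blast
      \<comment> \<open>Minimality of \<open>v\<close> makes it a prefix of the high part; deleting
        the zeros \<open>z\<close> at the end keeps the value and stays in the language.\<close>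
      have "w = take n w @ v @ z" using z by (metis append_take_drop_id)
      then have "take n w \<in> L_words v n"
        using w(1) L_appendD1[of "take n w @ v" z] sp(1) by (simp add: L_words_def)
      moreover from this have "x = ?h (take n w)"
        using h word_val_append[of g "take n w" "drop n w"] sp w(2) by simp
      ultimately show "x \<in> ?h ` L_words v n" by blast
    qed
    let ?c = "\<lambda>j. c j - weight n v j"
    have congr: "congr (\<lambda>j. f j (?h u)) c \<longleftrightarrow> congr (weight 0 u) ?c" if "u \<in> L_words v n" for u
      using that congr_word_val[of "u @ v" c] cong_tuple_add_left[of r a "weight n v" "weight 0 u" c]
      by (simp add: L_words_def weight_append[abs_def] add.commute)
    let ?U = "{u \<in> L_words v n. congr (weight 0 u) ?c}"
    have "{x \<in> ?h ` L_words v n. congr (\<lambda>j. f j x) c} = ?h ` ?U" using congr by blast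
    then have "{x \<in> ?B. congr (\<lambda>j. f j x) c} = ?h ` ?U" by (simp only: image)
    moreover have "inj_on ?h ?U" using inj by (rule inj_on_subset) blast
    ultimately have "card {x \<in> ?B. congr (\<lambda>j. f j x) c} = card ?U" by (simp only: card_image)
    moreover have "card ?B = card (L_words v n)" using card_image[OF inj] by (simp only: image)
    ultimately have "disc ?B (\<lambda>m j. f j m) c = disc (L_words v n) (weight 0) ?c"
      by (simp only: disc_def)
    then show ?thesis by blast
  qed
qed

text \<open>Packs the bounds into one error sequence, the form that \<open>interval_bound\<close>
  takes. The supremum exists because every discrepancy is at most
  \<open>card V * k ^ n\<close>.\<close>

lemma disc_bound:
  obtains \<epsilon> where "(\<lambda>n. \<epsilon> n / k ^ n) \<longlonglongrightarrow> 0" "\<And>n v c. \<bar>disc (L_words v n) (weight 0) c\<bar> \<le> \<epsilon> n"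
proof -
  define \<epsilon> where "\<epsilon> n = (SUP (v, c). \<bar>disc (L_words v n) (weight 0) c\<bar>)" for n
  have bdd: "bdd_above (range (\<lambda>(v, c). \<bar>disc (L_words v n) (weight 0) c\<bar>))" for n
  proof (rule bdd_aboveI2)
    fix x :: "nat list \<times> (nat \<Rightarrow> int)"
    have "real (card (L_words (fst x) n)) \<le> real (card V * k ^ n)"
      using card_L_words_le by (simp only: of_nat_le_iff)
    then show "(case x of (v, c) \<Rightarrow> \<bar>disc (L_words v n) (weight 0) c\<bar>) \<le> real (card V * k ^ n)"
      using abs_disc_le[OF finite_L_words, of "fst x" n "weight 0" "snd x"]
      by (simp add: case_prod_beta)
  qed
  have le: "\<bar>disc (L_words v n) (weight 0) c\<bar> \<le> \<epsilon> n" for n v c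
    using cSUP_upper[OF UNIV_I bdd[of n], of "(v, c)"] by (simp add: \<epsilon>_def)
  have "(\<lambda>n. \<epsilon> n / k ^ n) \<longlonglongrightarrow> 0"
  proof (rule tendstoI)
    fix e :: real assume "e > 0"
    have "eventually (\<lambda>n. \<forall>v c. \<bar>disc (L_words v n) (weight 0) c\<bar> \<le> e / 2 * k ^ n) sequentially"
      by (rule disc_L_words_small) (use \<open>e > 0\<close> in simp)
    then show "eventually (\<lambda>n. dist (\<epsilon> n / k ^ n) 0 < e) sequentially"
    proof eventually_elim
      case (elim n)
      have kn: "real (k ^ n) > 0" using k_ge_2 by simp
      have "\<epsilon> n \<le> e / 2 * k ^ n" unfolding \<epsilon>_def by (rule cSUP_least) (use elim in auto)
      moreover have "0 \<le> \<epsilon> n" using le[of "[]" n "\<lambda>_. 0"] by linarith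
      ultimately have "\<bar>\<epsilon> n / k ^ n\<bar> \<le> e / 2" using kn by (simp add: field_simps)
      then show ?case using \<open>e > 0\<close> by (simp only: dist_real_def diff_0_right)
    qed
  qed
  with le that show ?thesis by blast
qed

text \<open>This is the lower bound on the denominator that makes an error \<open>o(k^n)\<close>
  negligible.\<close>

lemma card_A_ge: "card (A \<inter> {..<g ^ n}) \<ge> k ^ n"
proof -
  have "inj_on (word_val g) (L_words [] n)"
    using L_word_val_inj by (auto simp: L_words_def intro: inj_onI)
  moreover have "word_val g ` L_words [] n \<subseteq> A \<inter> {..<g ^ n}"
    using L_word_val_less by (auto simp: A_set_def L_words_def)
  ultimately have "card (L_words [] n) \<le> card (A \<inter> {..<g ^ n})"
    using card_inj_on_le by blast
  then show ?thesis using card_L_words_Nil_ge[of n] by simp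
qed

lemma equidistributed:
  assumes "g \<ge> 2"
  shows "(\<lambda>N. card {n \<in> A \<inter> {..<N}. congr (\<lambda>j. f j n) c} / card (A \<inter> {..<N})) \<longlonglongrightarrow> 1 / card R"
proof -
  obtain \<epsilon> where \<epsilon>: "(\<lambda>n. \<epsilon> n / real k ^ n) \<longlonglongrightarrow> 0"
    "\<And>n v c. \<bar>disc (L_words v n) (weight 0) c\<bar> \<le> \<epsilon> n"
    using disc_bound by auto
  let ?F = "\<lambda>n j. f j n"
  define D where "D x y = disc (A \<inter> {x..<y}) ?F c" for x y
  have add: "D x z = D x y + D y z" if "x \<le> y" "y \<le> z" for x y z
  proof -
    have "A \<inter> {x..<z} = (A \<inter> {x..<y}) \<union> (A \<inter> {y..<z})" using that by auto
    moreover have "{n \<in> A \<inter> {x..<z}. congr (?F n) c}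
      = {n \<in> A \<inter> {x..<y}. congr (?F n) c} \<union> {n \<in> A \<inter> {y..<z}. congr (?F n) c}" using that by auto
    moreover have "card (A \<inter> {x..<y} \<union> A \<inter> {y..<z}) = card (A \<inter> {x..<y}) + card (A \<inter> {y..<z})"
      by (rule card_Un_disjoint) auto
    moreover have "card ({n \<in> A \<inter> {x..<y}. congr (?F n) c} \<union> {n \<in> A \<inter> {y..<z}. congr (?F n) c})
      = card {n \<in> A \<inter> {x..<y}. congr (?F n) c} + card {n \<in> A \<inter> {y..<z}. congr (?F n) c}"
      by (rule card_Un_disjoint) auto
    ultimately show ?thesis by (simp add: D_def disc_def add_divide_distrib)
  qed
  have block: "\<bar>D (q * g ^ j) (Suc q * g ^ j)\<bar> \<le> \<epsilon> j" if "q \<ge> 1" for q j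
  proof -
    have disc_empty: "disc {} ?F c = 0" by (simp add: disc_def)
    have "\<epsilon> j \<ge> 0" using \<epsilon>(2)[of "[]" j c] by linarith
    then show ?thesis
      using disc_block[OF that, of j c] \<epsilon>(2) disc_empty unfolding D_def
      by (elim disjE exE) (simp_all only: abs_zero)
  qed
  have k2: "real k \<ge> 2" using k_ge_2 by simp
  obtain P where P: "(\<lambda>m. P m / real k ^ m) \<longlonglongrightarrow> 0" "\<And>m N. N \<le> g ^ m \<Longrightarrow> \<bar>D 0 N\<bar> \<le> P m"
    using interval_bound[OF assms k2 add block \<epsilon>(1)] by blast
  show ?thesis
  proof (rule LIMSEQ_I)
    fix e :: real assume "e > 0"
    \<comment> \<open>For \<open>N\<close> between \<open>g ^ m\<close> and
      \<open>g ^ (m + 1)\<close> the error is bounded by \<open>P (m + 1)\<close> but the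
      denominator only by \<open>k ^ m\<close> from below; this loses a factor
      \<open>k\<close>.\<close>
    then have "e / k > 0" using k_ge_2 by simp
    from LIMSEQ_D[OF P(1) this] obtain m0 where
      m0: "\<And>m. m \<ge> m0 \<Longrightarrow> \<bar>P m / real k ^ m\<bar> < e / k" by auto
    \<comment> \<open>The summand 2 ensures \<open>N \<ge> 2\<close>, so that \<open>N\<close> lies
      above some \<open>g ^ m\<close> and not above \<open>g ^ (m + 1)\<close>.\<close>
    have "norm (card {n \<in> A \<inter> {..<N}. congr (?F n) c} / card (A \<inter> {..<N}) - 1 / card R) < e"
      if N: "N \<ge> g ^ m0 + 2" for N
    proof -
      obtain m where m: "g ^ m < N" "N \<le> g ^ (m + 1)" using ex_power_ivl2[OF assms, of N] N by auto
      have "g ^ m0 < g ^ (m + 1)" using N m(2) by linarith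
      then have "m0 \<le> m + 1" using assms by (simp add: power_strict_increasing_iff del: power_Suc)
      let ?W = "A \<inter> {..<N}"
      have "k ^ m \<le> card ?W"
        using card_A_ge[of m] card_mono[of ?W "A \<inter> {..<g ^ m}"] m(1) by fastforce
      then have W: "real k ^ m \<le> card ?W" by (metis of_nat_le_iff of_nat_power)
      have km: "real k ^ m > 0" using k_ge_2 by simp
      have ratio: "x / y - 1 / q = (x - y / q) / y" if "y > 0" for x y q :: real
        using that by (simp add: diff_divide_distrib)
      have "card {n \<in> ?W. congr (?F n) c} / card ?W - 1 / card R = D 0 N / card ?W"
        unfolding D_def disc_def lessThan_atLeast0[symmetric] by (rule ratio) (use W km in linarith)
      also have "\<bar>\<dots>\<bar> \<le> P (m + 1) / real k ^ m"
        using P(2)[OF m(2)] W km by (simp add: abs_divide frac_le)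
      also have "\<dots> = P (m + 1) / real k ^ (m + 1) * k" using k_ge_2 by simp
      also have "\<dots> < e / k * k"
      proof (rule mult_strict_right_mono)
        show "P (m + 1) / real k ^ (m + 1) < e / k" using m0[OF \<open>m0 \<le> m + 1\<close>] by linarith
      qed (use k_ge_2 in simp)
      also have "\<dots> = e" using k_ge_2 by simp
      finally show ?thesis by simp
    qed
    then show "\<exists>no. \<forall>N\<ge>no. norm (card {n \<in> A \<inter> {..<N}. congr (?F n) c} / card (A \<inter> {..<N}) - 1 / card R) < e"
      by blast
  qed
qed

end

theorem theorem4p8:
  fixes g r k p l :: nat and a :: "nat \<Rightarrow> nat"
    and f :: "nat \<Rightarrow> nat \<Rightarrow> int" and \<Sigma> :: "(nat \<Rightarrow> nat) set" and b :: "nat \<Rightarrow> int"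
  assumes "g \<ge> 2" and "r \<ge> 1"
    and "\<And>j. j \<in> {1..r} \<Longrightarrow> a j \<ge> 1"
    and "\<And>j. j \<in> {1..r} \<Longrightarrow> g_additive g (f j)"
    and "eventually_periodic g r a f"
    and "subshift g \<Sigma>" and "mixing_shift \<Sigma>" and "sofic \<Sigma>"
    and "k \<ge> 2" and "k_regular g k \<Sigma>"
    and "eventual_period g r a f p l"
    and "\<exists>w. synchronizing \<Sigma> w \<and> length w = l"
    and "markov_condition g r a f \<Sigma> k p l"
    and "b \<in> residue_tuples r a"
  shows "(\<lambda>N. real (card ({n \<in> A_set g \<Sigma>. \<forall>j\<in>{1..r}. [f j n = b j] (mod int (a j))} \<inter> {..<N}))
                / real (card (A_set g \<Sigma> \<inter> {..<N})))
         \<longlonglongrightarrow> 1 / real (\<Prod>j=1..r. a j)"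
proof -
  interpret weighted_shift g k \<Sigma> r a f p l
    by unfold_locales (use assms in blast)+
  have "{n \<in> A_set g \<Sigma>. \<forall>j\<in>{1..r}. [f j n = b j] (mod int (a j))} \<inter> {..<N}
      = {n \<in> A_set g \<Sigma> \<inter> {..<N}. cong_tuple r a (\<lambda>j. f j n) b}" for N
    by (auto simp: cong_tuple_def)
  then show ?thesis
    using equidistributed[OF \<open>g \<ge> 2\<close>, of b] by (simp only: card_residue_tuples)
qed

end
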